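(* Let $p,q$ be positive integers and $\varphi:[0,+\infty)\to(0,+\infty)$ a non-decreasing unbounded function. Let $f_1,f_2$ be meromorphic functions and $g_1$ an entire function such that at least one of $f_1,f_2$ is of regular relative $(p,q)$-$\varphi$ growth with respect to $g_1$. Suppose $g_1$ has the Property (A). Then $$\lambda_{g_1}(f_1\pm f_2)\le \max\{\lambda_{g_1}(f_1),\lambda_{g_1}(f_2)\}.$$ Equality holds when $\lambda_{g_1}(f_i)>\lambda_{g_1}(f_j)$ and $f_j$ is of regular relative $(p,q)$-$\varphi$ growth with respect to $g_1$, where $i,j\in\{1,2\}$, $i\ne j$.
   Context: Meromorphic and entire functions are on the whole plane $\mathbb{C}$. $M_g(r)=\max_{|z|=r}|g(z)|$, and $T_f(r)$ is the Nevanlinna characteristic function of $f$. For a non-constant entire $g$, $T_g$ is strictly increasing and continuous, with inverse $T_g^{-1}:(|g(0)|,\infty)\to(0,\infty)$, $\lim_{s\to\infty}T_g^{-1}(s)=\infty$. Iterated logarithms: $\log^{[0]}x=x$, $\log^{[k]}x=\log(\log^{[k-1]}x)$ for $k\ge1$. For fixed positive integers $p,q$ and fixed $\varphi$, the relative $(p,q)$-$\varphi$ order and lower order of a meromorphic $f$ with respect to an entire $g$ (full notation $\rho_g^{(p,q)}(f,\varphi)$, $\lambda_g^{(p,q)}(f,\varphi)$, abbreviated $\rho_g(f)$, $\lambda_g(f)$) are the $\limsup$ and the $\liminf$, respectively, as $r\to\infty$ of $\dfrac{\log^{[p]}T_g^{-1}(T_f(r))}{\log^{[q]}\varphi(r)}$.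 $f$ is of regular relative $(p,q)$-$\varphi$ growth with respect to $g$ if $\rho_g(f)=\lambda_g(f)$. A non-constant entire $g$ has the Property (A) if for every $\sigma>1$ and all sufficiently large $r$, $[M_g(r)]^2\le M_g(r^\sigma)$. Standing assumption: all growth indicators that occur are nonzero and finite. The symbol $\pm$ means either choice of sign, the same choice at every occurrence of the same expression. *)

theory Defs
  imports "HOL-Complex_Analysis.Complex_Analysis"
begin

text \<open>
  A meromorphic function on the plane is a total function \<open>f\<close> with \<open>f meromorphic_on UNIV\<close>.
  The values of such an \<open>f\<close> at its poles, or on any other discrete set, are arbitrary.
  They do not affect the quantities below: \<^const>\<open>is_pole\<close> and \<^const>\<open>zorder\<close> ignore the
  value at the point itself, and a circle meets a discrete set in finitely many points.
\<close>

definition pole_count :: "(complex \<Rightarrow> complex) \<Rightarrow> real \<Rightarrow> nat" where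
  "pole_count f t = (\<Sum>z | z \<in> cball 0 t \<and> is_pole f z. nat (- zorder f z))"

definition nevanlinna_N :: "(complex \<Rightarrow> complex) \<Rightarrow> real \<Rightarrow> real" where
  "nevanlinna_N f r =
     integral {0..r} (\<lambda>t. (real (pole_count f t) - real (pole_count f 0)) / t)
       + real (pole_count f 0) * ln r"

text \<open>\<open>ln (max 1 x)\<close> is \<open>log\<^sup>+ x\<close>.\<close>

definition nevanlinna_m :: "(complex \<Rightarrow> complex) \<Rightarrow> real \<Rightarrow> real" where
  "nevanlinna_m f r =
     integral {0..2 * pi} (\<lambda>\<theta>. ln (max 1 (norm (f (of_real r * cis \<theta>))))) / (2 * pi)"

definition nevanlinna_T :: "(complex \<Rightarrow> complex) \<Rightarrow> real \<Rightarrow> real" where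
  "nevanlinna_T f r = nevanlinna_m f r + nevanlinna_N f r"

text \<open>
  For a non-constant entire \<open>g\<close>, the characteristic may be constant near \<open>0\<close>, but every
  \<open>s > ln (max 1 (norm (g 0)))\<close> has exactly one preimage in \<open>(0, \<infinity>)\<close>, so the choice made
  by \<^const>\<open>inv_into\<close> is immaterial for all large \<open>s\<close>.
\<close>

definition nevanlinna_T_inv :: "(complex \<Rightarrow> complex) \<Rightarrow> real \<Rightarrow> real" where
  "nevanlinna_T_inv g s = inv_into {0<..} (nevanlinna_T g) s"

definition growth_ratio ::
    "nat \<Rightarrow> nat \<Rightarrow> (real \<Rightarrow> real) \<Rightarrow> (complex \<Rightarrow> complex) \<Rightarrow> (complex \<Rightarrow> complex) \<Rightarrow> real \<Rightarrow> real" where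
  "growth_ratio p q \<phi> g f r =
     (ln ^^ p) (nevanlinna_T_inv g (nevanlinna_T f r)) / (ln ^^ q) (\<phi> r)"

definition rel_order ::
    "nat \<Rightarrow> nat \<Rightarrow> (real \<Rightarrow> real) \<Rightarrow> (complex \<Rightarrow> complex) \<Rightarrow> (complex \<Rightarrow> complex) \<Rightarrow> ereal" where
  "rel_order p q \<phi> g f = Limsup at_top (\<lambda>r. ereal (growth_ratio p q \<phi> g f r))"

definition rel_lower_order ::
    "nat \<Rightarrow> nat \<Rightarrow> (real \<Rightarrow> real) \<Rightarrow> (complex \<Rightarrow> complex) \<Rightarrow> (complex \<Rightarrow> complex) \<Rightarrow> ereal" where
  "rel_lower_order p q \<phi> g f = Liminf at_top (\<lambda>r. ereal (growth_ratio p q \<phi> g f r))"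

definition regular_growth ::
    "nat \<Rightarrow> nat \<Rightarrow> (real \<Rightarrow> real) \<Rightarrow> (complex \<Rightarrow> complex) \<Rightarrow> (complex \<Rightarrow> complex) \<Rightarrow> bool" where
  "regular_growth p q \<phi> g f \<longleftrightarrow> rel_order p q \<phi> g f = rel_lower_order p q \<phi> g f"

definition max_modulus :: "(complex \<Rightarrow> complex) \<Rightarrow> real \<Rightarrow> real" where
  "max_modulus g r = (SUP z\<in>sphere 0 r. norm (g z))"

definition property_A :: "(complex \<Rightarrow> complex) \<Rightarrow> bool" where
  "property_A g \<longleftrightarrow> g holomorphic_on UNIV \<and> \<not> g constant_on UNIV \<and>
     (\<forall>\<sigma>>1. \<forall>\<^sub>F r in at_top. (max_modulus g r)\<^sup>2 \<le> max_modulus g (r powr \<sigma>))"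

end

theory Submission
  imports Defs "HOL-Real_Asymp.Real_Asymp"
begin

text \<open>
  Write \<open>T\<close> for the characteristic and \<open>M\<close> for the maximum modulus of \<open>g1\<close>. For entire functions
  \<open>T r \<le> log\<^sup>+ M(r) \<le> 12 T(2r)\<close>, the second inequality being a weak Harnack inequality for the
  subharmonic function \<open>log\<^sup>+ |g1|\<close>. Iterating Property (A) makes \<open>log M(x\<^sup>\<sigma> / 2)\<close> exceed any fixed multiple
  of \<open>log M(x)\<close>, for every \<open>\<sigma> > 1\<close>. With \<open>T(r, f1 \<plusminus> f2) \<le> T(r, f1) + T(r, f2) + log 2\<close> this gives
  \<open>R \<le> (max R1 R2)\<^sup>\<sigma>\<close> for large \<open>r\<close>, where \<open>R, R1, R2\<close> are the \<open>T\<close>-preimages of the three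
  characteristics. Iterated logarithms turn the exponent into at most a factor \<open>\<sigma>\<close>, which tends to 1, and regularity of
  one summand allows the lower limit to pass through the maximum. The equality case applies the same
  bound to a summand written as a difference of \<open>h\<close> and the other summand. The characteristics do
  tend to infinity: otherwise the function would be constant up to a discrete set and its lower order 0.
\<close>

section \<open>Mean value inequality for \<open>log\<^sup>+ |g|\<close>\<close>

text \<open>On each step of length \<open>d\<close> the integrand stays above its left value minus
  \<open>e\<close>; induction on \<open>j\<close> adds up the steps, each at a cost of
  \<open>e * d\<close>.\<close>

lemma riemann_sum_le:
  fixes U :: "real \<Rightarrow> real"
  assumes cont: "continuous_on {a..b} U"
    and osc: "\<And>x y. x \<in> {a..b} \<Longrightarrow> y \<in> {a..b} \<Longrightarrow> \<bar>x - y\<bar> \<le> d \<Longrightarrow> \<bar>U x - U y\<bar> \<le> e"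
    and d: "d \<ge> 0" and j: "a + real j * d \<le> b"
  shows "(\<Sum>k<j. U (a + real k * d)) * d \<le> integral {a..a + real j * d} U + e * d * real j"
  using j
proof (induction j)
  case 0
  then show ?case by simp
next
  case (Suc j)
  let ?x = "a + real j * d" and ?y = "a + real (Suc j) * d"
  have xy: "?x \<le> ?y" "a \<le> ?x" "?y \<le> b" "?y - ?x = d" using d Suc.prems by (auto simp: algebra_simps)
  have int: "U integrable_on {u..v}" if "a \<le> u" "v \<le> b" for u v
    by (rule integrable_continuous_interval, rule continuous_on_subset[OF cont]) (use that in auto)
  have "(U ?x - e) * d = integral {?x..?y} (\<lambda>_. U ?x - e)"
    using xy by (simp add: mult.commute)
  also have "\<dots> \<le> integral {?x..?y} U"
  proof (rule integral_le)
    show "U integrable_on {?x..?y}" by (rule int) (use xy in auto)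
    fix t assume t: "t \<in> {?x..?y}"
    have "t \<in> {a..b}" "?x \<in> {a..b}" "\<bar>?x - t\<bar> \<le> d"
      using t xy unfolding atLeastAtMost_iff by linarith+
    then have "\<bar>U ?x - U t\<bar> \<le> e" by (intro osc)
    then show "U ?x - e \<le> U t" by linarith
  qed auto
  finally have 1: "U ?x * d \<le> integral {?x..?y} U + e * d" by (simp add: algebra_simps)
  have "integral {a..?x} U + integral {?x..?y} U = integral {a..?y} U"
    by (rule Henstock_Kurzweil_Integration.integral_combine) (use xy int in auto)
  then show ?case using Suc.IH Suc.prems 1 xy by (simp add: algebra_simps)
qed

lemma periodic_integral_shift:
  fixes U :: "real \<Rightarrow> real"
  assumes cont: "continuous_on UNIV U" and per: "\<And>x. U (x + 2 * pi) = U x" and t: "t \<in> {0..2 * pi}"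
  shows "integral {t..t + 2 * pi} U = integral {0..2 * pi} U"
proof -
  have int: "U integrable_on {u..v}" for u v
    by (rule integrable_continuous_interval, rule continuous_on_subset[OF cont]) auto
  have "integral {0..t} U = integral {2*pi..t+2*pi} U"
    using integral_shift_Icc_real[of 0 t U "2*pi"] per by (simp add: o_def add.commute)
  moreover have "integral {0..t} U + integral {t..2*pi} U = integral {0..2*pi} U"
    "integral {t..2*pi} U + integral {2*pi..t+2*pi} U = integral {t..t+2*pi} U"
    by (rule Henstock_Kurzweil_Integration.integral_combine; use t int in auto)+
  ultimately show ?thesis by linarith
qed

text \<open>A single \<open>n\<close> has to serve every starting point \<open>t\<close>, since the
  mean value proof uses all rotations of a boundary point. Uniform continuity on
  \<open>{0..4*pi}\<close>, which contains every period starting in \<open>{0..2*pi}\<close>,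
  provides it.\<close>

lemma periodic_riemann_sum:
  fixes U :: "real \<Rightarrow> real"
  assumes cont: "continuous_on UNIV U" and per: "\<And>x. U (x + 2 * pi) = U x" and "e > 0"
  obtains n :: nat where "n \<ge> 1"
    "\<And>t. t \<in> {0..2 * pi} \<Longrightarrow>
       (\<Sum>k<n. U (t + 2 * pi * real k / real n)) / real n \<le> integral {0..2 * pi} U / (2 * pi) + e"
proof -
  have "uniformly_continuous_on {0..4*pi} U"
    by (rule compact_uniformly_continuous) (auto intro: continuous_on_subset[OF cont])
  then obtain d where d: "d > 0"
    "\<And>x y. x \<in> {0..4*pi} \<Longrightarrow> y \<in> {0..4*pi} \<Longrightarrow> dist x y < d \<Longrightarrow> dist (U x) (U y) < e"
    using \<open>e > 0\<close> by (fastforce simp: uniformly_continuous_on_def)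
  obtain n :: nat where n: "real n > 2 * pi / d" using reals_Archimedean2 by blast
  have n1: "n \<ge> 1" using n d(1) by (cases n) (auto simp: divide_simps)
  define h where "h = 2 * pi / real n"
  have h: "h > 0" "h < d" "real n * h = 2 * pi" using n n1 d by (auto simp: h_def field_simps)
  show thesis
  proof (rule that[OF n1])
    fix t :: real assume t: "t \<in> {0..2*pi}"
    have "(\<Sum>k<n. U (t + real k * h)) * h \<le> integral {t..t + real n * h} U + e * h * real n"
    proof (rule riemann_sum_le[where b = "t + 2*pi"])
      fix x y assume "x \<in> {t..t+2*pi}" "y \<in> {t..t+2*pi}" "\<bar>x - y\<bar> \<le> h"
      then show "\<bar>U x - U y\<bar> \<le> e"
        using d(2)[of x y] h t by (auto simp: dist_real_def)
    qed (use h in \<open>auto intro: continuous_on_subset[OF cont]\<close>)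
    also have "\<dots> = integral {0..2*pi} U + e * (2 * pi)"
      using periodic_integral_shift[OF cont per t] h(3) by (simp add: mult_ac)
    finally have *: "(\<Sum>k<n. U (t + real k * h)) * h \<le> integral {0..2*pi} U + e * (2 * pi)" .
    have "(\<Sum>k<n. U (t + 2 * pi * real k / real n)) / real n = (\<Sum>k<n. U (t + real k * h)) * h / (2 * pi)"
      using n1 by (simp add: h_def field_simps)
    also have "\<dots> \<le> (integral {0..2*pi} U + e * (2 * pi)) / (2 * pi)"
      using * by (intro divide_right_mono) auto
    also have "\<dots> = integral {0..2*pi} U / (2 * pi) + e" by (simp add: field_simps)
    finally show "(\<Sum>k<n. U (t + 2 * pi * real k / real n)) / real n \<le> integral {0..2 * pi} U / (2 * pi) + e" .
  qed
qed

text \<open>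
  The Riemann sums of \<open>log\<^sup>+ |g|\<close> over the rotations of a point \<open>z\<close> dominate
  \<open>log |\<Prod>\<^sub>k g(z \<omega>\<^sup>k)| / n\<close> with \<open>\<omega>\<close> a root of unity, and the maximum principle applies to this product.
\<close>

lemma ln_plus_submean:
  assumes hol: "g holomorphic_on ball 0 1" and cont: "continuous_on (cball 0 1) g"
  shows "ln (max 1 (norm (g 0))) \<le> integral {0..2*pi} (\<lambda>\<theta>. ln (max 1 (norm (g (cis \<theta>))))) / (2*pi)"
proof (rule field_le_epsilon)
  fix e :: real assume "e > 0"
  define U where "U = (\<lambda>\<theta>. ln (max 1 (norm (g (cis \<theta>)))))"
  have contU: "continuous_on UNIV U"
    unfolding U_def by (intro continuous_intros continuous_on_compose2[OF cont]) (auto simp: max_def)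
  have perU: "U (x + 2 * pi) = U x" for x by (simp add: U_def cis_mult[symmetric])
  have U0: "U x \<ge> 0" for x by (simp add: U_def)
  define J where "J = integral {0..2*pi} U / (2*pi) + e"
  have J: "J \<ge> 0" using \<open>e > 0\<close> U0 by (auto simp: J_def intro!: add_nonneg_nonneg divide_nonneg_nonneg integral_nonneg integrable_continuous_interval continuous_on_subset[OF contU])
  obtain n :: nat where n: "n \<ge> 1" and
    sum: "\<And>t. t \<in> {0..2 * pi} \<Longrightarrow> (\<Sum>k<n. U (t + 2 * pi * real k / real n)) / real n \<le> J"
    unfolding J_def using periodic_riemann_sum[OF contU perU \<open>e > 0\<close>] by blast
  define w where "w = (\<lambda>k. cis (2 * pi * real k / real n))"
  define G where "G = (\<lambda>z. \<Prod>k<n. g (z * w k))"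
  have nw: "norm (w k) = 1" for k by (simp add: w_def)
  have "norm (G 0) \<le> exp (real n * J)"
  proof (rule maximum_modulus_frontier[where f = G and S = "cball 0 1" and \<xi> = 0])
    show "G holomorphic_on interior (cball 0 1)"
      unfolding G_def by (intro holomorphic_intros holomorphic_on_compose_gen[OF _ hol, unfolded o_def]) (auto simp: norm_mult nw)
    show "continuous_on (closure (cball 0 1)) G"
      unfolding G_def by (intro continuous_intros continuous_on_compose2[OF cont]) (auto simp: norm_mult nw)
    fix z :: complex assume "z \<in> frontier (cball 0 1)"
    then have "norm z = 1" by simp
    then obtain t where t: "t \<in> {0..2*pi}" "z = cis t"
      using Arg2pi_eq[of z] Arg2pi_ge_0[of z] Arg2pi_lt_2pi[of z] by (metis atLeastAtMost_iff cis_conv_exp less_imp_le mult_1 of_real_1)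
    have "norm (G z) = (\<Prod>k<n. norm (g (z * w k)))" by (simp add: G_def prod_norm)
    also have "\<dots> \<le> (\<Prod>k<n. exp (U (t + 2 * pi * real k / real n)))"
      by (intro prod_mono) (auto simp: U_def t w_def cis_mult exp_ln_iff)
    also have "\<dots> = exp (\<Sum>k<n. U (t + 2 * pi * real k / real n))" by (simp add: exp_sum)
    also have "\<dots> \<le> exp (real n * J)" using sum[OF t(1)] n by (simp add: field_simps)
    finally show "norm (G z) \<le> exp (real n * J)" .
  qed auto
  then have *: "norm (g 0) ^ n \<le> exp J ^ n" by (simp add: G_def norm_power exp_of_nat_mult)
  have "norm (g 0) \<le> exp J" by (rule power_le_imp_le_base[of _ "n - 1"]) (use * n in auto)
  \<comment> \<open>Passing from \<open>|g 0|\<close> to \<open>max 1 |g 0|\<close> needs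
    \<open>1 \<le> exp J\<close>, which is where \<open>J \<ge> 0\<close> enters.\<close>
  then have "max 1 (norm (g 0)) \<le> exp J" using J by simp
  then have "ln (max 1 (norm (g 0))) \<le> J" by (metis ln_exp ln_mono less_max_iff_disj zero_less_one exp_gt_zero)
  then show "ln (max 1 (norm (g 0))) \<le> integral {0..2*pi} (\<lambda>\<theta>. ln (max 1 (norm (g (cis \<theta>))))) / (2*pi) + e"
    by (simp add: J_def U_def)
qed

lemma periodic_integral_multiple:
  fixes U :: "real \<Rightarrow> real"
  assumes cont: "continuous_on UNIV U" and per: "\<And>x. U (x + 2 * pi) = U x"
  shows "integral {0..2 * pi * real j} U = real j * integral {0..2 * pi} U"
proof (induction j)
  case (Suc j)
  have int: "U integrable_on {u..v}" for u v
    by (rule integrable_continuous_interval, rule continuous_on_subset[OF cont]) auto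
  have per_j: "U (x + 2 * pi * real j) = U x" for x
  proof (induction j)
    case (Suc j)
    then show ?case using per[of "x + 2 * pi * real j"] by (simp add: algebra_simps)
  qed auto
  have "integral {0..2*pi} U = integral {2*pi*real j..2*pi*real (Suc j)} U"
    using integral_shift_Icc_real[of 0 "2*pi" U "2*pi*real j"] per_j
    by (simp add: o_def add.commute algebra_simps)
  moreover have "integral {0..2*pi*real j} U + integral {2*pi*real j..2*pi*real (Suc j)} U
      = integral {0..2*pi*real (Suc j)} U"
    by (rule Henstock_Kurzweil_Integration.integral_combine) (use int in auto)
  ultimately show ?case using Suc.IH by (simp add: algebra_simps)
qed auto

text \<open>
  The Moebius map \<open>\<psi>\<close> of the disc with \<open>\<psi> 0 = a\<close> satisfies \<open>\<psi> (cis \<theta>) = cis (\<tau> \<theta>)\<close>, where \<open>\<tau>\<close>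
  is a primitive of the Poisson kernel \<open>P\<close>, and \<open>1/3 \<le> P \<le> 3\<close> for \<open>|a| = 1/2\<close>. The sharp constant is
  3; the factor 12 comes from covering the range of \<open>\<tau>\<close> crudely by four periods.
\<close>

lemma ln_plus_half_disc:
  assumes hol: "g holomorphic_on UNIV" and a: "norm a = 1/2"
  shows "ln (max 1 (norm (g a))) \<le> 12 * (integral {0..2*pi} (\<lambda>\<theta>. ln (max 1 (norm (g (cis \<theta>))))) / (2*pi))"
proof -
  define V where "V = (\<lambda>\<theta>. ln (max 1 (norm (g (cis \<theta>)))))"
  have contg: "continuous_on A g" for A
    using hol holomorphic_on_imp_continuous_on continuous_on_subset by blast
  have contV: "continuous_on A V" for A
    unfolding V_def by (intro continuous_intros continuous_on_compose2[OF contg[of UNIV]]) (auto simp: max_def)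
  have perV: "V (x + 2 * pi) = V x" for x by (simp add: V_def cis_mult[symmetric])
  have V0: "V x \<ge> 0" for x by (simp add: V_def)
  define \<psi> where "\<psi> = (\<lambda>w. (w + a) / (1 + cnj a * w))"
  have D: "norm (1 + cnj a * w) \<ge> 1/2" "norm (1 + cnj a * w) \<le> 3/2" if "norm w \<le> 1" for w
  proof -
    have *: "norm (cnj a * w) \<le> 1/2" using that by (simp add: norm_mult a)
    show "norm (1 + cnj a * w) \<ge> 1/2" using * norm_triangle_ineq2[of 1 "- (cnj a * w)"] by simp
    show "norm (1 + cnj a * w) \<le> 3/2" using * norm_triangle_ineq[of 1 "cnj a * w"] by simp
  qed
  have D0: "1 + cnj a * w \<noteq> 0" if "norm w \<le> 1" for w using D(1)[OF that] by auto
  define q where "q = (\<lambda>\<theta>. \<psi> (cis \<theta>))"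
  \<comment> \<open>This is the mean value inequality for \<open>g \<circ> \<psi>\<close> at 0,
    where its value is \<open>g a\<close>.\<close>
  have sub: "ln (max 1 (norm (g a))) \<le> integral {0..2*pi} (\<lambda>\<theta>. ln (max 1 (norm (g (q \<theta>))))) / (2*pi)"
  proof -
    have "(g \<circ> \<psi>) holomorphic_on ball 0 1"
      by (rule holomorphic_on_compose_gen[OF _ hol])
        (auto simp: \<psi>_def D0 intro!: holomorphic_intros)
    moreover have "continuous_on (cball 0 1) (g \<circ> \<psi>)"
      by (rule continuous_on_compose) (auto simp: \<psi>_def D0 intro!: continuous_intros contg)
    ultimately show ?thesis
      using ln_plus_submean[of "g \<circ> \<psi>"] by (simp add: \<psi>_def q_def)
  qed
  \<comment> \<open>The numerator \<open>3/4\<close> is \<open>1 - |a|^2\<close>.\<close>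
  define P where "P = (\<lambda>\<theta>. (3/4) / (norm (1 + cnj a * cis \<theta>))\<^sup>2)"
  have P: "1/3 \<le> P \<theta>" "P \<theta> \<le> 3" for \<theta>
  proof -
    have n: "norm (1 + cnj a * cis \<theta>) \<ge> 1/2" "norm (1 + cnj a * cis \<theta>) \<le> 3/2"
      using D[of "cis \<theta>"] by auto
    have "(norm (1 + cnj a * cis \<theta>))\<^sup>2 \<ge> (1/2)\<^sup>2" "(norm (1 + cnj a * cis \<theta>))\<^sup>2 \<le> (3/2)\<^sup>2"
      using n by (intro power_mono; simp)+
    then show "1/3 \<le> P \<theta>" "P \<theta> \<le> 3" by (auto simp: P_def divide_simps power2_eq_square)
  qed
  have P0: "0 \<le> P \<theta>" for \<theta> by (simp add: P_def)
  have contP: "continuous_on A P" for A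
    unfolding P_def using D0 by (intro continuous_intros) auto
  have norm_q: "norm (q \<theta>) = 1" for \<theta>
  proof -
    \<comment> \<open>On the unit circle conjugation is inversion, so numerator and denominator of
      \<open>\<psi>\<close> have the same modulus.\<close>
    have "cis \<theta> + a = cis \<theta> * cnj (1 + cnj a * cis \<theta>)" by (simp add: algebra_simps cis_cnj cis_mult)
    then have "norm (cis \<theta> + a) = norm (1 + cnj a * cis \<theta>)" by (simp add: norm_mult del: complex_cnj_add complex_cnj_mult)
    then show ?thesis using D0[of "cis \<theta>"] by (simp add: q_def \<psi>_def norm_divide)
  qed
  \<comment> \<open>The argument of \<open>q\<close> moves with speed \<open>P\<close>, because
    \<open>w * \<psi>' w / \<psi> w\<close> equals \<open>P\<close> on the unit circle.\<close>
  have q': "(q has_vector_derivative \<i> * of_real (P \<theta>) * q \<theta>) (at \<theta> within A)" for \<theta> A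
  proof -
    let ?c = "cis \<theta>" and ?D = "1 + cnj a * cis \<theta>"
    have D0': "?D \<noteq> 0" using D0[of ?c] by simp
    have aa: "cnj a * a = 1/4" using complex_norm_square[of a] by (simp add: a power2_eq_square mult.commute)
    have "(\<psi> has_field_derivative (?D - cnj a * (?c + a)) / ?D\<^sup>2) (at ?c)"
      unfolding \<psi>_def using D0' by (auto intro!: derivative_eq_intros simp: power2_eq_square algebra_simps)
    moreover have "(cis has_vector_derivative \<i> * ?c) (at \<theta> within A)"
      unfolding cis_conv_exp by (auto intro!: derivative_eq_intros has_vector_derivative_real_field simp: mult_ac)
    ultimately have "(q has_vector_derivative (\<i> * ?c) * ((?D - cnj a * (?c + a)) / ?D\<^sup>2)) (at \<theta> within A)"
      unfolding q_def using field_vector_diff_chain_within[of cis _ \<theta> A \<psi>] has_field_derivative_at_within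
      by (fastforce simp: o_def)
    moreover have "(\<i> * ?c) * ((?D - cnj a * (?c + a)) / ?D\<^sup>2) = \<i> * of_real (P \<theta>) * q \<theta>"
    proof -
      have 1: "?D - cnj a * (?c + a) = 3/4" using aa by (simp add: algebra_simps)
      have 2: "of_real (P \<theta>) = (3/4) / (?D * cnj ?D)"
        unfolding P_def complex_norm_square[symmetric] by simp
      have 3: "q \<theta> = ?c * cnj ?D / ?D"
        by (simp add: q_def \<psi>_def algebra_simps cis_cnj cis_mult)
      have "cnj ?D \<noteq> 0" using D0' by (metis complex_cnj_zero_iff)
      moreover have "(\<i> * c) * ((3/4) / D\<^sup>2) = \<i> * ((3/4) / (D * D')) * (c * D' / D)"
        if "D \<noteq> 0" "D' \<noteq> 0" for c D D' :: complex
        using that by (simp add: field_simps power2_eq_square)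
      ultimately show ?thesis unfolding 1 2 3 using D0' by blast
    qed
    ultimately show ?thesis by simp
  qed
  define t0 where "t0 = Arg2pi (q 0)"
  have t0: "0 \<le> t0" "t0 \<le> 2*pi" "cis t0 = q 0"
    using Arg2pi_ge_0[of "q 0"] Arg2pi_lt_2pi[of "q 0"] Arg2pi_eq[of "q 0"] norm_q[of 0]
    by (auto simp: t0_def cis_conv_exp)
  define \<tau> where "\<tau> = (\<lambda>\<theta>. t0 + integral {0..\<theta>} P)"
  have \<tau>': "(\<tau> has_real_derivative P \<theta>) (at \<theta> within {0..2*pi})" if "\<theta> \<in> {0..2*pi}" for \<theta>
    unfolding \<tau>_def using integral_has_real_derivative[OF contP that] by (auto intro!: derivative_eq_intros)
  have Pint: "P integrable_on {u..v}" for u v by (intro integrable_continuous_interval contP)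
  \<comment> \<open>A start of at most \<open>2*pi\<close> plus an integral of at most
    \<open>3 * 2*pi\<close> gives the four periods.\<close>
  have \<tau>_bounds: "0 \<le> \<tau> \<theta>" "\<tau> \<theta> \<le> 8*pi" if "\<theta> \<in> {0..2*pi}" for \<theta>
  proof -
    have "integral {0..\<theta>} P \<ge> 0" by (intro integral_nonneg Pint P0)
    moreover have "integral {0..\<theta>} P \<le> integral {0..\<theta>} (\<lambda>_. 3)" using P(2) by (intro integral_le Pint) auto
    ultimately show "0 \<le> \<tau> \<theta>" "\<tau> \<theta> \<le> 8*pi" using t0 that by (auto simp: \<tau>_def)
  qed
  have q_eq: "q \<theta> = cis (\<tau> \<theta>)" if \<theta>: "\<theta> \<in> {0..2*pi}" for \<theta>
  proof -
    \<comment> \<open>\<open>E\<close> compares \<open>q\<close> with the candidate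
      \<open>cis \<tau>\<close>: both rotate at speed \<open>P\<close>, so \<open>E\<close> is
      constant, and \<open>E 0 = 1\<close> by the choice of \<open>t0\<close>.\<close>
    define E where "E = (\<lambda>\<theta>. q \<theta> * exp (- \<i> * of_real (\<tau> \<theta>)))"
    have "(E has_vector_derivative 0) (at x within {0..2*pi})" if x: "x \<in> {0..2*pi}" for x
    proof -
      have "((\<lambda>x. - \<i> * of_real (\<tau> x)) has_vector_derivative - \<i> * of_real (P x)) (at x within {0..2*pi})"
        by (intro has_vector_derivative_mult_right has_vector_derivative_of_real \<tau>' x)
      then have "((\<lambda>x. exp (- \<i> * of_real (\<tau> x))) has_vector_derivative
          (- \<i> * of_real (P x)) * exp (- \<i> * of_real (\<tau> x))) (at x within {0..2*pi})"
        using field_vector_diff_chain_within[of "\<lambda>x. - \<i> * of_real (\<tau> x)" "- \<i> * of_real (P x)" x "{0..2*pi}" exp "exp (- \<i> * of_real (\<tau> x))"]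
        by (simp add: o_def has_field_derivative_at_within)
      from has_vector_derivative_mult[OF q'[of x "{0..2*pi}"] this]
      show ?thesis unfolding E_def by (simp add: algebra_simps)
    qed
    then have "\<exists>c. \<forall>x\<in>{0..2*pi}. E x = c"
      using has_vector_derivative_zero_constant[of "{0..2*pi}" E] by (metis convex_real_interval(5))
    then have "E \<theta> = E 0" using \<theta> by (metis atLeastAtMost_iff order_refl order_trans)
    also have "E 0 = cis t0 * cis (- t0)" unfolding E_def \<tau>_def t0(3) by (simp add: cis_conv_exp)
    finally have "q \<theta> * cis (- \<tau> \<theta>) = 1" by (simp add: E_def cis_conv_exp cis_mult exp_minus)
    then have "q \<theta> * cis (- \<tau> \<theta>) * cis (\<tau> \<theta>) = cis (\<tau> \<theta>)" by simp
    then show ?thesis by (simp add: mult.assoc cis_mult)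
  qed
  have le: "\<tau> 0 \<le> \<tau> (2*pi)"
    by (auto simp: \<tau>_def P0 intro!: integral_nonneg Pint)
  have "((\<lambda>x. P x *\<^sub>R V (\<tau> x)) has_integral integral {\<tau> 0..\<tau> (2*pi)} V) {0..2*pi}"
    by (rule has_integral_substitution[where c = 0 and d = "8*pi"])
      (use le \<tau>_bounds contV \<tau>' in auto)
  then have subst: "integral {0..2*pi} (\<lambda>x. P x * V (\<tau> x)) = integral {\<tau> 0..\<tau> (2*pi)} V"
    by (simp add: integral_unique)
  have cont\<tau>: "continuous_on {0..2*pi} \<tau>"
    using \<tau>' by (meson DERIV_continuous continuous_on_eq_continuous_within)
  have "integral {0..2*pi} (\<lambda>\<theta>. ln (max 1 (norm (g (q \<theta>))))) = integral {0..2*pi} (\<lambda>\<theta>. V (\<tau> \<theta>))"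
    by (intro Henstock_Kurzweil_Integration.integral_cong) (simp add: V_def q_eq)
  \<comment> \<open>Since \<open>3 * P \<ge> 1\<close> and \<open>V \<ge> 0\<close>, the weight that
    the substitution by \<open>\<tau>\<close> requires can be inserted at the cost of a factor
    3.\<close>
  also have "\<dots> \<le> integral {0..2*pi} (\<lambda>x. 3 * (P x * V (\<tau> x)))"
  proof (rule integral_le)
    fix x
    show "V (\<tau> x) \<le> 3 * (P x * V (\<tau> x))" using mult_right_mono[OF P(1) V0[of "\<tau> x"], of x] by simp
  qed (intro integrable_continuous_interval continuous_intros contP continuous_on_compose2[OF contV[of UNIV] cont\<tau>]; auto)+
  also have "\<dots> = 3 * integral {\<tau> 0..\<tau> (2*pi)} V" using subst by simp
  also have "integral {\<tau> 0..\<tau> (2*pi)} V \<le> integral {0..2*pi*real 4} V"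
    by (rule integral_subset_le) (use \<tau>_bounds[of 0] \<tau>_bounds[of "2*pi"] V0 in \<open>auto intro!: integrable_continuous_interval contV\<close>)
  also have "\<dots> = 4 * integral {0..2*pi} V"
    using periodic_integral_multiple[OF contV perV, of 4] by simp
  finally have "integral {0..2*pi} (\<lambda>\<theta>. ln (max 1 (norm (g (q \<theta>))))) \<le> 12 * integral {0..2*pi} V" by simp
  then have "integral {0..2*pi} (\<lambda>\<theta>. ln (max 1 (norm (g (q \<theta>))))) / (2*pi) \<le> (12 * integral {0..2*pi} V) / (2*pi)"
    by (intro divide_right_mono) auto
  then show ?thesis using sub unfolding V_def by simp
qed

text \<open>Rescaling by \<open>2 * r\<close> turns the circle of radius \<open>2 * r\<close> into
  the unit circle and \<open>z\<close> into a point of modulus \<open>1/2\<close>.\<close>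

lemma ln_plus_le_nevanlinna_m:
  assumes hol: "g holomorphic_on UNIV" and "norm z = r" "r > 0"
  shows "ln (max 1 (norm (g z))) \<le> 12 * nevanlinna_m g (2 * r)"
proof -
  have "(\<lambda>w. g (of_real (2*r) * w)) holomorphic_on UNIV"
    by (intro holomorphic_on_compose_gen[OF _ hol, unfolded o_def] holomorphic_intros) auto
  from ln_plus_half_disc[OF this, of "z / of_real (2*r)"] assms
  show ?thesis by (simp add: nevanlinna_m_def norm_divide)
qed

section \<open>Counting function and proximity function of a meromorphic function\<close>

text \<open>The value 0 away from poles allows sums over any finite superset of the poles, so that
  several functions can share one index set.\<close>

definition pole_mult :: "(complex \<Rightarrow> complex) \<Rightarrow> complex \<Rightarrow> nat" where
  "pole_mult f z = (if is_pole f z then nat (- zorder f z) else 0)"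

text \<open>Through Laurent series, adding functions becomes adding series. The zero series, with
  subdegree 0, is covered too.\<close>

lemma pole_mult_laurent:
  assumes "(\<lambda>w. f (z + w)) has_laurent_expansion F"
  shows "pole_mult f z = nat (- fls_subdegree F)"
proof (cases "is_pole f z")
  case True
  then have "F \<noteq> 0" using is_pole_fls_subdegree_iff[OF assms] by auto
  then show ?thesis using True has_laurent_expansion_zorder[OF assms] by (simp add: pole_mult_def)
next
  case False
  then show ?thesis using is_pole_fls_subdegree_iff[OF assms] by (simp add: pole_mult_def)
qed

lemma pole_mult_add_le:
  assumes "f meromorphic_on {z}" "g meromorphic_on {z}"
  shows "pole_mult (\<lambda>w. f w + g w) z \<le> pole_mult f z + pole_mult g z"
proof -
  obtain F G where F: "(\<lambda>w. f (z + w)) has_laurent_expansion F"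
    and G: "(\<lambda>w. g (z + w)) has_laurent_expansion G"
    using assms unfolding meromorphic_on_def by blast
  have FG: "(\<lambda>w. f (z + w) + g (z + w)) has_laurent_expansion F + G"
    using F G by (rule has_laurent_expansion_add)
  \<comment> \<open>Cancellation can only raise the subdegree; the outer \<open>min 0\<close> covers
    \<open>F + G = 0\<close>, whose subdegree is 0 by convention.\<close>
  have "fls_subdegree (F + G) \<ge> min 0 (min (fls_subdegree F) (fls_subdegree G))"
    by (cases "F + G = 0") (auto intro!: fls_subdegree_geI)
  then show ?thesis
    using pole_mult_laurent[OF F] pole_mult_laurent[OF G]
      pole_mult_laurent[of "\<lambda>w. f w + g w" z "F + G"] FG by auto
qed

lemma finite_poles:
  assumes "f meromorphic_on UNIV"
  shows "finite {z \<in> cball 0 t. is_pole f z}"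
proof -
  have "{z. is_pole f z} sparse_in UNIV"
    using meromorphic_on_imp_not_pole_cosparse[OF assms] by (simp add: eventually_cosparse)
  then have "finite (cball 0 t \<inter> {z. is_pole f z})"
    by (intro sparse_in_compact_finite) (auto intro: sparse_in_subset)
  then show ?thesis by (simp add: Int_def)
qed

lemma pole_count_eq_sum:
  assumes "finite A" "{z \<in> cball 0 t. is_pole f z} \<subseteq> A"
  shows "pole_count f t = (\<Sum>z\<in>A. if norm z \<le> t then pole_mult f z else 0)"
proof -
  have "pole_count f t = (\<Sum>z | z \<in> cball 0 t \<and> is_pole f z. if norm z \<le> t then pole_mult f z else 0)"
    unfolding pole_count_def by (intro sum.cong) (auto simp: pole_mult_def)
  also have "\<dots> = (\<Sum>z\<in>A. if norm z \<le> t then pole_mult f z else 0)"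
    by (rule sum.mono_neutral_left) (use assms in \<open>auto simp: pole_mult_def\<close>)
  finally show ?thesis .
qed

lemma pole_count_0: "pole_count f 0 = pole_mult f 0"
  using pole_count_eq_sum[of "{0}" 0 f] by auto

lemma has_integral_truncated_inverse:
  fixes a r :: real
  assumes "0 < a" "a \<le> r"
  shows "((\<lambda>t. if a \<le> t then 1 / t else 0) has_integral ln (r / a)) {0..r}"
proof -
  have "((\<lambda>t. 1 / t) has_integral (ln r - ln a)) {a..r}"
    using assms by (intro fundamental_theorem_of_calculus)
      (auto intro!: derivative_eq_intros simp: has_real_derivative_iff_has_vector_derivative[symmetric])
  then have "((\<lambda>t. if t \<in> {a..r} then 1 / t else 0) has_integral (ln r - ln a)) {0..r}"
    using assms by (subst has_integral_restrict) auto
  then have "((\<lambda>t. if a \<le> t then 1 / t else 0) has_integral (ln r - ln a)) {0..r}"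
    by (rule has_integral_eq[rotated]) auto
  then show ?thesis using assms by (simp add: ln_div)
qed

text \<open>A pole \<open>z \<noteq> 0\<close> switches on the integrand \<open>1/t\<close> at
  \<open>t = |z|\<close> and so contributes \<open>ln (r / |z|)\<close> per unit of
  multiplicity.\<close>

lemma nevanlinna_N_eq_sum:
  assumes fin: "finite A" and A: "A \<subseteq> cball 0 r" "{z \<in> cball 0 r. is_pole f z} \<subseteq> A" and r: "r > 0"
  shows "nevanlinna_N f r = (\<Sum>z\<in>A - {0}. real (pole_mult f z) * ln (r / norm z)) + real (pole_mult f 0) * ln r"
proof -
  have "((\<lambda>t. \<Sum>z\<in>A - {0}. real (pole_mult f z) * (if norm z \<le> t then 1 / t else 0)) has_integral
      (\<Sum>z\<in>A - {0}. real (pole_mult f z) * ln (r / norm z))) {0..r}"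
    using A by (intro has_integral_sum has_integral_mult_right has_integral_truncated_inverse) (auto simp: fin)
  moreover have "(\<Sum>z\<in>A - {0}. real (pole_mult f z) * (if norm z \<le> t then 1 / t else 0))
      = (real (pole_count f t) - real (pole_count f 0)) / t" if "t \<in> {0..r}" for t
  proof -
    have "pole_count f t = (\<Sum>z\<in>insert 0 A. if norm z \<le> t then pole_mult f z else 0)"
      using A that by (intro pole_count_eq_sum) (auto simp: fin subset_iff)
    also have "\<dots> = pole_mult f 0 + (\<Sum>z\<in>A - {0}. if norm z \<le> t then pole_mult f z else 0)"
      using fin that by (simp add: sum.insert_remove)
    finally have "real (pole_count f t) - real (pole_count f 0)
        = (\<Sum>z\<in>A - {0}. if norm z \<le> t then real (pole_mult f z) else 0)"
      by (simp add: pole_count_0 of_nat_sum if_distrib cong: if_cong)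
    then show ?thesis by (simp add: sum_divide_distrib if_distrib if_distribR cong: if_cong)
  qed
  ultimately have "((\<lambda>t. (real (pole_count f t) - real (pole_count f 0)) / t) has_integral
      (\<Sum>z\<in>A - {0}. real (pole_mult f z) * ln (r / norm z))) {0..r}"
    by (rule has_integral_eq[rotated])
  then show ?thesis by (simp add: nevanlinna_N_def integral_unique pole_count_0)
qed

text \<open>Over a common set of poles the claim is termwise. The weights
  \<open>ln (r / |z|)\<close> are nonnegative in the disc, and the weight \<open>ln r\<close> of the
  origin is so because \<open>r \<ge> 1\<close>.\<close>

lemma nevanlinna_N_add_le:
  assumes f: "f meromorphic_on UNIV" and g: "g meromorphic_on UNIV" and r: "r \<ge> 1"
  shows "nevanlinna_N (\<lambda>z. f z + g z) r \<le> nevanlinna_N f r + nevanlinna_N g r"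
proof -
  let ?h = "\<lambda>z. f z + g z"
  have h: "?h meromorphic_on UNIV" using f g by (intro meromorphic_intros)
  define A where "A = {z \<in> cball 0 r. is_pole f z} \<union> {z \<in> cball 0 r. is_pole g z} \<union> {z \<in> cball 0 r. is_pole ?h z}"
  have fin: "finite A" and A: "A \<subseteq> cball 0 r" using finite_poles f g h by (auto simp: A_def)
  have N: "nevanlinna_N k r = (\<Sum>z\<in>A - {0}. real (pole_mult k z) * ln (r / norm z)) + real (pole_mult k 0) * ln r"
    if "k \<in> {f, g, ?h}" for k
    by (rule nevanlinna_N_eq_sum[OF fin A]) (use that r in \<open>auto simp: A_def\<close>)
  have le: "pole_mult ?h z \<le> pole_mult f z + pole_mult g z" for z
    using f g by (intro pole_mult_add_le) (auto intro: meromorphic_on_subset)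
  have mono: "real (pole_mult ?h z) * x \<le> real (pole_mult f z) * x + real (pole_mult g z) * x"
    if "x \<ge> 0" for x z
    using mult_right_mono[OF of_nat_mono[OF le[of z], where 'a = real] that] by (simp add: algebra_simps)
  have "(\<Sum>z\<in>A - {0}. real (pole_mult ?h z) * ln (r / norm z))
      \<le> (\<Sum>z\<in>A - {0}. real (pole_mult f z) * ln (r / norm z) + real (pole_mult g z) * ln (r / norm z))"
    by (intro sum_mono mono) (use A in \<open>auto simp: divide_simps\<close>)
  moreover have "real (pole_mult ?h 0) * ln r \<le> real (pole_mult f 0) * ln r + real (pole_mult g 0) * ln r"
    by (rule mono) (use r in auto)
  ultimately show ?thesis by (simp add: N sum.distrib)
qed

text \<open>All terms of the sum are nonnegative, so one pole already gives logarithmic growth. The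
  \<open>max 1\<close> lets a pole at the origin, whose term is at least \<open>ln r\<close>, share
  the bound.\<close>

lemma nevanlinna_N_ge:
  assumes f: "f meromorphic_on UNIV" and z: "is_pole f z" "norm z \<le> r" and r: "r \<ge> 1"
  shows "nevanlinna_N f r \<ge> ln r - ln (max 1 (norm z))"
proof -
  define A where "A = {z \<in> cball 0 r. is_pole f z}"
  have fin: "finite A" and A: "A \<subseteq> cball 0 r" using finite_poles f by (auto simp: A_def)
  have N: "nevanlinna_N f r = (\<Sum>z\<in>A - {0}. real (pole_mult f z) * ln (r / norm z)) + real (pole_mult f 0) * ln r"
    by (rule nevanlinna_N_eq_sum[OF fin A]) (use r in \<open>auto simp: A_def\<close>)
  have nonneg: "real (pole_mult f w) * ln (r / norm w) \<ge> 0" if "w \<in> A - {0}" for w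
    using A that by (auto simp: divide_simps)
  have "zorder f z < 0"
    using z f by (intro isolated_pole_imp_neg_zorder meromorphic_on_isolated_singularity)
      (auto intro: meromorphic_on_subset)
  then have 1: "1 \<le> real (pole_mult f z)" using z by (simp add: pole_mult_def)
  show ?thesis
  proof (cases "z = 0")
    case True
    have "ln r \<le> real (pole_mult f 0) * ln r" using mult_right_mono[OF 1, of "ln r"] r True by simp
    moreover have "(\<Sum>z\<in>A - {0}. real (pole_mult f z) * ln (r / norm z)) \<ge> 0"
      by (rule sum_nonneg) (rule nonneg)
    ultimately show ?thesis using N True by simp
  next
    case False
    have "ln (r / norm z) \<le> real (pole_mult f z) * ln (r / norm z)"
      using mult_right_mono[OF 1, of "ln (r / norm z)"] z False by simp
    also have "\<dots> \<le> (\<Sum>z\<in>A - {0}. real (pole_mult f z) * ln (r / norm z))"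
      by (rule member_le_sum) (use False z fin nonneg in \<open>auto simp: A_def\<close>)
    also have "\<dots> \<le> nevanlinna_N f r" using N r by simp
    finally have "ln r - ln (norm z) \<le> nevanlinna_N f r" using r False by (simp add: ln_div)
    moreover have "ln (norm z) \<le> ln (max 1 (norm z))" using False by (intro ln_mono) auto
    ultimately show ?thesis by linarith
  qed
qed

lemma nevanlinna_N_no_poles:
  assumes "\<And>z. \<not> is_pole f z"
  shows "nevanlinna_N f r = 0"
  by (simp add: nevanlinna_N_def pole_count_def assms)

lemma nevanlinna_T_uminus [simp]: "nevanlinna_T (\<lambda>z. - f z) r = nevanlinna_T f r"
  by (simp add: nevanlinna_T_def nevanlinna_m_def nevanlinna_N_def pole_count_def)

section \<open>Measurability and integrability of \<open>log\<^sup>+ |f|\<close> on circles\<close>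

lemma countable_singularities:
  assumes "f meromorphic_on UNIV"
  shows "countable {z. \<not> f analytic_on {z}}"
proof -
  have "finite (cball 0 (real n) \<inter> {z. \<not> f analytic_on {z}})" for n
    by (intro sparse_in_compact_finite) (use meromorphic_on_imp_sparse_singularities[OF assms] in \<open>auto intro: sparse_in_subset\<close>)
  then have "countable (\<Union>n. cball 0 (real n) \<inter> {z. \<not> f analytic_on {z}})"
    by (intro countable_UN) (auto intro: countable_finite)
  moreover have "{z. \<not> f analytic_on {z}} \<subseteq> (\<Union>n. cball 0 (real n) \<inter> {z. \<not> f analytic_on {z}})"
    using real_arch_simple by auto
  ultimately show ?thesis by (rule countable_subset[rotated])
qed

text \<open>Continuity off a countable set suffices, so the arbitrary values at the singularities do
  no harm.\<close>

lemma meromorphic_borel_measurable: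
  assumes "f meromorphic_on UNIV"
  shows "f \<in> borel_measurable borel"
proof (rule borel_measurable_continuous_countable_exceptions[OF countable_singularities[OF assms]])
  show "continuous_on (- {z. \<not> f analytic_on {z}}) f"
    by (intro continuous_at_imp_continuous_on ballI analytic_at_imp_isCont) auto
qed

text \<open>At a pole \<open>m\<close> is its order, and the left side is the modulus of
  \<open>zor_poly\<close>, bounded on a compact disc. Otherwise \<open>f\<close> has a finite limit
  and \<open>m = 0\<close> works.\<close>

lemma meromorphic_local_bound:
  assumes "f meromorphic_on {z}"
  obtains C m where "C > 0" "\<forall>\<^sub>F w in at z. norm (f w) * norm (w - z) ^ m \<le> C"
proof (cases "is_pole f z")
  case False
  have "not_essential f z" using assms by (simp add: meromorphic_at_iff)
  then obtain c where "f \<midarrow>z\<rightarrow> c" using False by (auto simp: not_essential_def)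
  then have "\<forall>\<^sub>F w in at z. norm (f w) < norm c + 1"
    by (intro order_tendstoD(2)[OF tendsto_norm]) auto
  then show ?thesis by (intro that[of "norm c + 1" 0]) (auto elim: eventually_mono intro: add_nonneg_pos)
next
  case True
  have iso: "isolated_singularity_at f z" and ness: "not_essential f z"
    using assms by (auto simp: meromorphic_at_iff)
  have "\<exists>\<^sub>F w in at z. f w \<noteq> 0"
    using True by (intro eventually_frequently non_zero_neighbour_pole) auto
  from zorder_exist[OF iso ness this] obtain r where r: "r > 0"
    "zor_poly f z holomorphic_on cball z r"
    "\<And>w. w \<in> cball z r - {z} \<Longrightarrow> f w = zor_poly f z w * (w - z) powi zorder f z" by auto
  define m where "m = nat (- zorder f z)"
  have neg: "zorder f z = - int m"
    using isolated_pole_imp_neg_zorder[OF iso True] by (simp add: m_def)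
  have "compact (zor_poly f z ` cball z r)"
    using r by (intro compact_continuous_image holomorphic_on_imp_continuous_on) auto
  then obtain C where C: "C > 0" "\<And>w. w \<in> cball z r \<Longrightarrow> norm (zor_poly f z w) \<le> C"
    using compact_imp_bounded bounded_pos by (metis imageI)
  show ?thesis
  proof (rule that[of C m])
    have "\<forall>\<^sub>F w in at z. w \<in> ball z r - {z}"
      using r(1) by (intro eventually_at_in_open) auto
    then show "\<forall>\<^sub>F w in at z. norm (f w) * norm (w - z) ^ m \<le> C"
    proof eventually_elim
      case (elim w)
      then have "f w = zor_poly f z w * (w - z) powi (- int m)" using r(3)[of w] neg by auto
      then have "norm (f w) * norm (w - z) ^ m = norm (zor_poly f z w)"
        using elim by (simp add: power_int_minus norm_mult norm_inverse norm_power)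
      then show ?case using C(2)[of w] elim by auto
    qed
  qed (rule C)
qed

text \<open>The parametrisation has speed \<open>r\<close>, half of which survives near
  \<open>\<theta>0\<close>. This converts distance from a pole into distance of angles.\<close>

lemma circle_local_lower_bound:
  assumes "r > 0"
  shows "\<forall>\<^sub>F \<theta> in at \<theta>0. norm (of_real r * cis \<theta> - of_real r * cis \<theta>0) \<ge> r / 2 * \<bar>\<theta> - \<theta>0\<bar>"
proof -
  have "((\<lambda>\<theta>. of_real r * cis \<theta>) has_vector_derivative of_real r * (\<i> * cis \<theta>0)) (at \<theta>0)"
    unfolding cis_conv_exp by (auto intro!: derivative_eq_intros has_vector_derivative_real_field simp: mult_ac)
  then obtain d where d: "d > 0"
    and D: "\<And>\<theta>. norm (\<theta> - \<theta>0) < d \<Longrightarrow> norm (of_real r * cis \<theta> - of_real r * cis \<theta>0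
      - (\<theta> - \<theta>0) *\<^sub>R (of_real r * (\<i> * cis \<theta>0))) \<le> r / 2 * norm (\<theta> - \<theta>0)"
    using assms unfolding has_vector_derivative_def has_derivative_at_alt by (meson half_gt_zero)
  have "\<forall>\<^sub>F \<theta> in at \<theta>0. dist \<theta> \<theta>0 < d" using d by (auto simp: eventually_at)
  then show ?thesis
  proof eventually_elim
    case (elim \<theta>)
    then have "norm (of_real r * cis \<theta> - of_real r * cis \<theta>0 - (\<theta> - \<theta>0) *\<^sub>R (of_real r * (\<i> * cis \<theta>0)))
        \<le> r / 2 * \<bar>\<theta> - \<theta>0\<bar>"
      using D[of \<theta>] by (simp add: dist_norm)
    moreover have "norm ((\<theta> - \<theta>0) *\<^sub>R (of_real r * (\<i> * cis \<theta>0))) = r * \<bar>\<theta> - \<theta>0\<bar>"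
      using assms by (simp add: norm_mult)
    ultimately show ?case
      using norm_triangle_ineq2[of "(\<theta> - \<theta>0) *\<^sub>R (of_real r * (\<i> * cis \<theta>0))" "of_real r * cis \<theta> - of_real r * cis \<theta>0"]
        norm_minus_commute[of "(\<theta> - \<theta>0) *\<^sub>R (of_real r * (\<i> * cis \<theta>0))" "of_real r * cis \<theta> - of_real r * cis \<theta>0"]
      by linarith
  qed
qed

text \<open>A pole produces only a logarithmic singularity, and
  \<open>ln (1/x) \<le> 2 * x powr (-1/2)\<close>, which is integrable at 0.\<close>

lemma ln_plus_inverse_power_le:
  fixes x y K :: real
  assumes x: "0 < x" "x \<le> 1" and y: "y * x ^ m \<le> K" and K: "K \<ge> 1"
  shows "ln (max 1 y) \<le> (ln K + 2 * real m) * x powr (- 1/2)"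
proof -
  have "y \<le> K / x ^ m" using x y by (simp add: field_simps)
  moreover have "1 \<le> K / x ^ m" using x K power_le_one[of x m] by (simp add: field_simps)
  ultimately have "ln (max 1 y) \<le> ln (K / x ^ m)" by (intro ln_mono) auto
  also have "\<dots> = ln K + real m * ln (1 / x)" using x K by (simp add: ln_div ln_realpow)
  also have "ln (1 / x) \<le> (1 / x) powr (1/2) / (1/2)" using x by (intro ln_powr_bound) auto
  also have "(1 / x) powr (1/2) / (1/2) = 2 * x powr (-1/2)" using x by (simp add: powr_minus powr_divide field_simps)
  finally have "ln (max 1 y) \<le> ln K + real m * (2 * x powr (-1/2))" by (simp add: mult_left_mono)
  moreover have "ln K * 1 \<le> ln K * x powr (-1/2)"
  proof (rule mult_left_mono)
    have "x powr 0 \<le> x powr (-1/2)" using x by (intro powr_mono') auto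
    then show "1 \<le> x powr (-1/2)" using x by simp
  qed (use K in auto)
  ultimately show ?thesis by (simp add: algebra_simps)
qed

lemma integrable_abs_powr:
  fixes c d :: real
  assumes "d \<ge> 0"
  shows "(\<lambda>x. \<bar>x - c\<bar> powr (- 1/2)) integrable_on {c - d..c + d}"
proof -
  have 1: "(\<lambda>x. \<bar>x\<bar> powr (- 1/2)) integrable_on {0..d}"
    by (rule integrable_eq[OF integrable_on_powr_from_0[of "-1/2" d]]) (use assms in auto)
  moreover have "(\<lambda>x. \<bar>x\<bar> powr (- 1/2)) integrable_on {-d..0}"
    using Henstock_Kurzweil_Integration.integrable_reflect_real[where f="\<lambda>x::real. \<bar>x\<bar> powr (- 1/2)" and a=0 and b=d] 1 by (simp only: abs_minus_cancel minus_zero)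
  ultimately have "(\<lambda>x. \<bar>x\<bar> powr (- 1/2)) integrable_on {-d..d}"
    using assms by (intro Henstock_Kurzweil_Integration.integrable_combine[of "-d" 0 d]) simp_all
  then show ?thesis
    using integrable_on_shift_Icc_real[of "\<lambda>x. \<bar>x - c\<bar> powr (-1/2)" c "-d" d] by (simp add: o_def add.commute)
qed

lemma ln_plus_meromorphic_locally_integrable:
  assumes f: "f meromorphic_on UNIV" and r: "r > 0"
  obtains d where "d > 0" "(\<lambda>\<theta>. ln (max 1 (norm (f (of_real r * cis \<theta>))))) absolutely_integrable_on {\<theta>0 - d..\<theta>0 + d}"
proof -
  define V where "V = (\<lambda>\<theta>. ln (max 1 (norm (f (of_real r * cis \<theta>)))))"
  have meas: "V \<in> borel_measurable borel"
  proof -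
    have "(\<lambda>\<theta>. of_real r * cis \<theta>) \<in> borel_measurable borel"
      by (intro borel_measurable_continuous_onI continuous_intros)
    then have "(\<lambda>\<theta>. f (of_real r * cis \<theta>)) \<in> borel_measurable borel"
      using meromorphic_borel_measurable[OF f] by (rule measurable_compose)
    then show ?thesis unfolding V_def by measurable
  qed
  have V0: "V \<theta> \<ge> 0" for \<theta> by (simp add: V_def)
  let ?z = "of_real r * cis \<theta>0"
  obtain C m where C: "C > 0" "\<forall>\<^sub>F w in at ?z. norm (f w) * norm (w - ?z) ^ m \<le> C"
    using meromorphic_local_bound[of f ?z] f meromorphic_on_subset by blast
  \<comment> \<open>Dividing by \<open>(r/2) ^ m\<close> accounts for the change from distances in
    the plane to angles; the bound from below by 1 makes \<open>ln K \<ge> 0\<close>.\<close>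
  define K where "K = max 1 (C / (r/2) ^ m)"
  have "filterlim (\<lambda>\<theta>. of_real r * cis \<theta>) (at ?z) (at \<theta>0)"
  proof (rule filterlim_atI)
    have "isCont (\<lambda>\<theta>. of_real r * cis \<theta>) \<theta>0" unfolding cis_conv_exp by (intro continuous_intros)
    then show "((\<lambda>\<theta>. of_real r * cis \<theta>) \<longlongrightarrow> ?z) (at \<theta>0)" by (simp add: isCont_def)
    have "\<forall>\<^sub>F \<theta> in at \<theta>0. \<theta> \<noteq> \<theta>0" by (simp add: eventually_at_filter)
    with circle_local_lower_bound[OF r, of \<theta>0]
    show "\<forall>\<^sub>F \<theta> in at \<theta>0. of_real r * cis \<theta> \<noteq> ?z"
      by eventually_elim (use r in \<open>auto simp: mult_le_0_iff\<close>)
  qed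
  then have "\<forall>\<^sub>F \<theta> in at \<theta>0. norm (f (of_real r * cis \<theta>)) * norm (of_real r * cis \<theta> - ?z) ^ m \<le> C"
    by (rule eventually_compose_filterlim[OF C(2)])
  with circle_local_lower_bound[OF r, of \<theta>0]
  have "\<forall>\<^sub>F \<theta> in at \<theta>0. norm (f (of_real r * cis \<theta>)) * \<bar>\<theta> - \<theta>0\<bar> ^ m \<le> K"
  proof eventually_elim
    case (elim \<theta>)
    have "(r / 2 * \<bar>\<theta> - \<theta>0\<bar>) ^ m \<le> norm (of_real r * cis \<theta> - ?z) ^ m"
      using elim(1) r by (intro power_mono) auto
    from mult_left_mono[OF this norm_ge_zero[of "f (of_real r * cis \<theta>)"]]
    have "norm (f (of_real r * cis \<theta>)) * (r / 2 * \<bar>\<theta> - \<theta>0\<bar>) ^ m \<le> C"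
      using elim(2) by linarith
    then have "norm (f (of_real r * cis \<theta>)) * \<bar>\<theta> - \<theta>0\<bar> ^ m \<le> C / (r/2) ^ m"
      using r by (simp add: power_mult_distrib field_simps)
    then show ?case by (simp add: K_def)
  qed
  then obtain d where d: "d > 0"
    "\<And>\<theta>. \<theta> \<noteq> \<theta>0 \<Longrightarrow> dist \<theta> \<theta>0 < d \<Longrightarrow> norm (f (of_real r * cis \<theta>)) * \<bar>\<theta> - \<theta>0\<bar> ^ m \<le> K"
    unfolding eventually_at by blast
  \<comment> \<open>Halving puts the closed interval inside the open neighbourhood; the cap 1
    supplies the condition \<open>x \<le> 1\<close> of the power bound.\<close>
  define d' where "d' = min 1 (d/2)"
  have d': "d' > 0" "d' < d" "d' \<le> 1" using d(1) by (auto simp: d'_def)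
  define B where "B = ln K + 2 * real m"
  have "V absolutely_integrable_on {\<theta>0 - d'..\<theta>0 + d'}"
  proof (rule measurable_bounded_by_integrable_imp_absolutely_integrable)
    have "(\<lambda>x. \<bar>x - \<theta>0\<bar> powr (- 1/2)) integrable_on {\<theta>0 - d'..\<theta>0 + d'}"
      using d' by (intro integrable_abs_powr) auto
    then have "(\<lambda>x. B * \<bar>x - \<theta>0\<bar> powr (- 1/2)) integrable_on {\<theta>0 - d'..\<theta>0 + d'}"
      by (intro integrable_on_mult_right)
    \<comment> \<open>As \<open>0 powr (-1/2) = 0\<close>, the majorant has to be reset at
      \<open>\<theta>0\<close>, where the value of \<open>V\<close> is arbitrary.\<close>
    then show "(\<lambda>x. if x = \<theta>0 then V \<theta>0 else B * \<bar>x - \<theta>0\<bar> powr (- 1/2)) integrable_on {\<theta>0 - d'..\<theta>0 + d'}"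
      by (rule integrable_spike_finite[of "{\<theta>0}", rotated 2]) auto
    show "V \<in> borel_measurable (lebesgue_on {\<theta>0 - d'..\<theta>0 + d'})"
      using meas by (intro measurable_restrict_space1 measurable_completion) simp
    show "{\<theta>0 - d'..\<theta>0 + d'} \<in> sets lebesgue" by simp
    fix x assume x: "x \<in> {\<theta>0 - d'..\<theta>0 + d'}"
    show "norm (V x) \<le> (if x = \<theta>0 then V \<theta>0 else B * \<bar>x - \<theta>0\<bar> powr (- 1/2))"
    proof (cases "x = \<theta>0")
      case False
      have x': "0 < \<bar>x - \<theta>0\<bar>" "\<bar>x - \<theta>0\<bar> \<le> d'" using False x by auto
      have "norm (f (of_real r * cis x)) * \<bar>x - \<theta>0\<bar> ^ m \<le> K"
        using False x' d' by (intro d(2)) (auto simp: dist_real_def)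
      moreover have "1 \<le> K" by (simp add: K_def)
      ultimately have "V x \<le> B * \<bar>x - \<theta>0\<bar> powr (- 1/2)"
        unfolding V_def B_def using x' d' by (intro ln_plus_inverse_power_le) linarith+
      then show ?thesis using False V0[of x] by simp
    qed (use V0 in auto)
  qed
  then show thesis using that[OF d'(1)] unfolding V_def by simp
qed

text \<open>Local integrability holds around every angle, whether or not a pole lies there, so
  compactness leaves finitely many intervals.\<close>

lemma ln_plus_meromorphic_integrable:
  assumes f: "f meromorphic_on UNIV" and r: "r > 0"
  shows "(\<lambda>\<theta>. ln (max 1 (norm (f (of_real r * cis \<theta>))))) integrable_on {0..2 * pi}"
proof -
  define V where "V = (\<lambda>\<theta>. ln (max 1 (norm (f (of_real r * cis \<theta>)))))"
  have "\<forall>\<theta>. \<exists>d. d > 0 \<and> V absolutely_integrable_on {\<theta> - d..\<theta> + d}"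
    unfolding V_def by (intro allI, rule ln_plus_meromorphic_locally_integrable[OF f r]) (intro exI conjI)
  from choice[OF this] obtain d where "\<forall>\<theta>. d \<theta> > 0 \<and> V absolutely_integrable_on {\<theta> - d \<theta>..\<theta> + d \<theta>}"
    by (rule exE)
  then have d: "\<And>\<theta>. d \<theta> > 0" "\<And>\<theta>. V absolutely_integrable_on {\<theta> - d \<theta>..\<theta> + d \<theta>}"
    by simp_all
  obtain T where T: "finite T" "{0..2*pi} \<subseteq> (\<Union>\<theta>\<in>T. ball \<theta> (d \<theta>))"
    by (rule compactE_image[of "{0..2*pi}" "{0..2*pi}" "\<lambda>\<theta>. ball \<theta> (d \<theta>)"])
      (use d(1) in \<open>auto intro: centre_in_ball[THEN iffD2]\<close>)
  have sub: "{0..2*pi} \<subseteq> (\<Union>\<theta>\<in>T. {\<theta> - d \<theta>..\<theta> + d \<theta>})"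
    by (rule order_trans[OF T(2) UN_mono]) (auto simp only: mem_ball dist_real_def atLeastAtMost_iff abs_less_iff)
  have "V absolutely_integrable_on (\<Union>\<theta>\<in>T. {\<theta> - d \<theta>..\<theta> + d \<theta>})"
    using T(1) d(2) by (intro set_integrable_UN) auto
  then have "V absolutely_integrable_on {0..2*pi}"
    by (rule set_integrable_subset) (use sub in auto)
  then show ?thesis unfolding V_def by (rule set_lebesgue_integral_eq_integral(1))
qed

section \<open>Subadditivity of the characteristic\<close>

lemma ln_plus_add_le:
  fixes a b :: "'a::real_normed_vector"
  shows "ln (max 1 (norm (a + b))) \<le> ln (max 1 (norm a)) + ln (max 1 (norm b)) + ln 2"
proof -
  \<comment> \<open>Both maxima are at least 1, so each is at most their product, and twice the
    product bounds \<open>|a| + |b|\<close>.\<close>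
  have "max 1 (norm (a + b)) \<le> max 1 (norm a) * max 1 (norm b) * 2"
  proof -
    let ?A = "max 1 (norm a)" and ?B = "max 1 (norm b)"
    have "?A * 1 \<le> ?A * ?B" "1 * ?B \<le> ?A * ?B" by (intro mult_left_mono mult_right_mono; simp)+
    moreover have "1 \<le> ?A" "norm a \<le> ?A" "norm b \<le> ?B" by auto
    ultimately have "norm (a + b) \<le> ?A * ?B * 2" "1 \<le> ?A * ?B * 2"
      using norm_triangle_ineq[of a b] by linarith+
    then show ?thesis by simp
  qed
  then have "ln (max 1 (norm (a + b))) \<le> ln (max 1 (norm a) * max 1 (norm b) * 2)"
    by (intro ln_mono) auto
  also have "\<dots> = ln (max 1 (norm a)) + ln (max 1 (norm b)) + ln 2"
    by (subst ln_mult_pos, simp, simp, subst ln_mult_pos) (auto simp: less_max_iff_disj)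
  finally show ?thesis .
qed

lemma nevanlinna_m_add_le:
  assumes f: "f meromorphic_on UNIV" and g: "g meromorphic_on UNIV" and r: "r > 0"
  shows "nevanlinna_m (\<lambda>z. f z + g z) r \<le> nevanlinna_m f r + nevanlinna_m g r + ln 2"
proof -
  let ?L = "\<lambda>f \<theta>. ln (max 1 (norm (f (of_real r * cis \<theta> :: complex) :: complex)))"
  have h: "(\<lambda>z. f z + g z) meromorphic_on UNIV" using f g by (intro meromorphic_intros)
  note int = ln_plus_meromorphic_integrable[OF f r] ln_plus_meromorphic_integrable[OF g r]
    ln_plus_meromorphic_integrable[OF h r]
  have "integral {0..2*pi} (?L (\<lambda>z. f z + g z)) \<le> integral {0..2*pi} (\<lambda>\<theta>. ?L f \<theta> + ?L g \<theta> + ln 2)"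
    by (intro integral_le int integrable_add integrable_on_const ln_plus_add_le) auto
  also have "\<dots> = integral {0..2*pi} (?L f) + integral {0..2*pi} (?L g) + 2 * pi * ln 2"
    using has_integral_add[OF has_integral_add[OF int(1,2)[THEN integrable_integral]] has_integral_const_real[of "ln 2" 0 "2*pi"]]
    by (simp add: integral_unique)
  finally have "integral {0..2*pi} (?L (\<lambda>z. f z + g z)) / (2*pi)
      \<le> (integral {0..2*pi} (?L f) + integral {0..2*pi} (?L g) + 2 * pi * ln 2) / (2*pi)"
    by (intro divide_right_mono) auto
  then show ?thesis by (simp add: nevanlinna_m_def add_divide_distrib)
qed

lemma nevanlinna_T_add_le:
  assumes "f meromorphic_on UNIV" "g meromorphic_on UNIV" "r \<ge> 1"
  shows "nevanlinna_T (\<lambda>z. f z + g z) r \<le> nevanlinna_T f r + nevanlinna_T g r + ln 2"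
  using nevanlinna_m_add_le[of f g r] nevanlinna_N_add_le[of f g r] assms
  by (simp add: nevanlinna_T_def)

lemma nevanlinna_T_diff_le:
  assumes "f meromorphic_on UNIV" "g meromorphic_on UNIV" "r \<ge> 1"
  shows "nevanlinna_T (\<lambda>z. f z - g z) r \<le> nevanlinna_T f r + nevanlinna_T g r + ln 2"
  using nevanlinna_T_add_le[of f "\<lambda>z. - g z" r] assms by (simp add: meromorphic_on_uminus)

lemma nevanlinna_m_nonneg:
  assumes "f meromorphic_on UNIV" "r > 0"
  shows "nevanlinna_m f r \<ge> 0"
  unfolding nevanlinna_m_def
  using ln_plus_meromorphic_integrable[OF assms] by (intro divide_nonneg_nonneg integral_nonneg) auto

section \<open>Characteristic and maximum modulus of entire functions\<close>

text \<open>The supremum runs over the circle only; the maximum principle carries it into the disc.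
  Compactness supplies the boundedness without which \<open>SUP\<close> gives no upper
  bound.\<close>

lemma norm_le_max_modulus:
  assumes hol: "g holomorphic_on UNIV" and z: "norm z \<le> r"
  shows "norm (g z) \<le> max_modulus g r"
proof (rule maximum_modulus_frontier[where f = g and S = "cball 0 r" and \<xi> = z])
  have cont: "continuous_on A g" for A
    using hol holomorphic_on_imp_continuous_on continuous_on_subset by blast
  then show "continuous_on (closure (cball 0 r)) g" by blast
  show "g holomorphic_on interior (cball 0 r)" using hol holomorphic_on_subset by blast
  have "compact ((\<lambda>z. norm (g z)) ` sphere 0 r)"
    by (intro compact_continuous_image continuous_intros cont) auto
  then have bdd: "bdd_above ((\<lambda>z. norm (g z)) ` sphere 0 r)"
    by (intro bounded_imp_bdd_above compact_imp_bounded)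
  fix w :: complex assume "w \<in> frontier (cball 0 r)"
  then have "w \<in> sphere 0 r" by simp
  then show "norm (g w) \<le> max_modulus g r"
    unfolding max_modulus_def by (intro cSUP_upper bdd)
qed (use z in auto)

lemma max_modulus_attained:
  assumes "g holomorphic_on UNIV" and "r \<ge> 0"
  obtains z where "norm z = r" "max_modulus g r = norm (g z)"
proof -
  have "continuous_on (sphere 0 r) (\<lambda>z. norm (g z))"
    using assms holomorphic_on_imp_continuous_on continuous_on_subset by (blast intro: continuous_on_norm)
  moreover have "sphere (0::complex) r \<noteq> {}" using assms by simp
  ultimately obtain z where z: "z \<in> sphere 0 r" "\<forall>w\<in>sphere 0 r. norm (g w) \<le> norm (g z)"
    using continuous_attains_sup[of "sphere 0 r" "\<lambda>z. norm (g z)"] by auto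
  have "max_modulus g r = norm (g z)"
    unfolding max_modulus_def by (rule cSup_eq_maximum) (use z in auto)
  then show thesis using that z by simp
qed

lemma max_modulus_mono:
  assumes "g holomorphic_on UNIV" "0 \<le> r" "r \<le> s"
  shows "max_modulus g r \<le> max_modulus g s"
  using max_modulus_attained[OF assms(1,2)] norm_le_max_modulus[OF assms(1)] assms(3) by metis

text \<open>By Liouville some value exceeds \<open>B\<close>, and the maximum principle keeps it
  below \<open>max_modulus g r\<close> for all larger \<open>r\<close>.\<close>

lemma max_modulus_at_top:
  assumes hol: "g holomorphic_on UNIV" and "\<not> g constant_on UNIV"
  shows "filterlim (max_modulus g) at_top at_top"
  unfolding filterlim_at_top
proof
  fix B :: real
  have "\<not> (\<forall>w\<in>range g. norm w \<le> B)"
    using Liouville_theorem[OF hol] assms(2) bounded_iff by blast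
  then obtain z where z: "norm (g z) > B" by (auto simp: not_le)
  show "\<forall>\<^sub>F r in at_top. B \<le> max_modulus g r"
    using eventually_ge_at_top[of "norm z"]
  proof eventually_elim
    case (elim r)
    then show ?case using norm_le_max_modulus[OF hol elim] z by linarith
  qed
qed

lemma nevanlinna_T_entire:
  assumes "g holomorphic_on UNIV"
  shows "nevanlinna_T g = nevanlinna_m g"
proof
  fix r
  have "\<not> is_pole g z" for z using assms by (intro not_is_pole_holomorphic[of UNIV]) auto
  then show "nevanlinna_T g r = nevanlinna_m g r"
    by (simp add: nevanlinna_T_def nevanlinna_N_no_poles)
qed

lemma nevanlinna_T_le_ln_max_modulus:
  assumes hol: "g holomorphic_on UNIV" and r: "r > 0"
  shows "nevanlinna_T g r \<le> ln (max 1 (max_modulus g r))"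
proof -
  have "g meromorphic_on UNIV" using hol by (simp add: analytic_on_imp_meromorphic_on analytic_on_open)
  note int = ln_plus_meromorphic_integrable[OF this r]
  have "integral {0..2*pi} (\<lambda>\<theta>. ln (max 1 (norm (g (of_real r * cis \<theta>)))))
      \<le> integral {0..2*pi} (\<lambda>_. ln (max 1 (max_modulus g r)))"
  proof (rule integral_le[OF int])
    fix \<theta>
    have "norm (g (of_real r * cis \<theta>)) \<le> max_modulus g r"
      using r by (intro norm_le_max_modulus[OF hol]) (simp add: norm_mult)
    then show "ln (max 1 (norm (g (of_real r * cis \<theta>)))) \<le> ln (max 1 (max_modulus g r))"
      by (intro ln_mono) (auto simp: max_def)
  qed auto
  then show ?thesis by (simp add: nevanlinna_T_entire[OF hol] nevanlinna_m_def field_simps)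
qed

text \<open>The weak Harnack bound is applied at a point where the maximum on the circle is
  attained.\<close>

lemma ln_max_modulus_le_nevanlinna_T:
  assumes hol: "g holomorphic_on UNIV" and r: "r > 0"
  shows "ln (max 1 (max_modulus g r)) \<le> 12 * nevanlinna_T g (2 * r)"
proof -
  obtain z where "norm z = r" "max_modulus g r = norm (g z)"
    using max_modulus_attained[OF hol, of r] r by auto
  then show ?thesis using ln_plus_le_nevanlinna_m[OF hol, of z r] r by (simp add: nevanlinna_T_entire[OF hol])
qed

lemma ln_max_modulus_at_top:
  assumes "g holomorphic_on UNIV" "\<not> g constant_on UNIV"
  shows "filterlim (\<lambda>r. ln (max 1 (max_modulus g r))) at_top at_top"
proof (rule filterlim_compose[OF ln_at_top])
  show "filterlim (\<lambda>r. max 1 (max_modulus g r)) at_top at_top"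
    by (rule filterlim_at_top_mono[OF max_modulus_at_top[OF assms]]) auto
qed

lemma nevanlinna_T_entire_at_top:
  assumes hol: "g holomorphic_on UNIV" and nc: "\<not> g constant_on UNIV"
  shows "filterlim (nevanlinna_T g) at_top at_top"
proof (rule filterlim_at_top_mono)
  have "filterlim (\<lambda>r. ln (max 1 (max_modulus g (r / 2)))) at_top at_top"
    by (rule filterlim_compose[OF ln_max_modulus_at_top[OF assms]]) real_asymp
  then show "filterlim (\<lambda>r. (1/12) * ln (max 1 (max_modulus g (r / 2)))) at_top at_top"
    by (subst filterlim_tendsto_pos_mult_at_top_iff[OF tendsto_const]) auto
  show "\<forall>\<^sub>F r in at_top. (1/12) * ln (max 1 (max_modulus g (r / 2))) \<le> nevanlinna_T g r"
    using eventually_gt_at_top[of 0]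
  proof eventually_elim
    case (elim r)
    then show ?case using ln_max_modulus_le_nevanlinna_T[OF hol, of "r / 2"] by simp
  qed
qed

section \<open>The inverse of the characteristic\<close>

lemma nevanlinna_T_entire_continuous:
  assumes hol: "g holomorphic_on UNIV"
  shows "continuous_on A (nevanlinna_T g)"
proof -
  have cont: "continuous_on UNIV g" using hol by (rule holomorphic_on_imp_continuous_on)
  have "continuous_on A (\<lambda>r. integral (cbox 0 (2*pi)) (\<lambda>\<theta>. ln (max 1 (norm (g (of_real r * cis \<theta>))))))"
  proof (rule integral_continuous_on_param)
    have "max 1 (norm w) \<noteq> 0" for w :: complex by (metis max.cobounded1 not_one_le_zero)
    then show "continuous_on (A \<times> cbox 0 (2*pi)) (\<lambda>(r, \<theta>). ln (max 1 (norm (g (of_real r * cis \<theta>)))))"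
      unfolding split_beta by (intro continuous_intros continuous_on_compose2[OF cont]) auto
  qed
  then show ?thesis
    unfolding nevanlinna_T_entire[OF hol] nevanlinna_m_def by (auto intro!: continuous_intros)
qed

text \<open>Continuity and growth give a preimage that is at least 1 by the intermediate value
  theorem, so \<open>inv_into\<close> returns a genuine positive preimage.\<close>

lemma nevanlinna_T_inv_eventually:
  assumes hol: "g holomorphic_on UNIV" and nc: "\<not> g constant_on UNIV"
  shows "\<forall>\<^sub>F s in at_top. nevanlinna_T_inv g s > 0 \<and> nevanlinna_T g (nevanlinna_T_inv g s) = s"
  using eventually_ge_at_top[of "nevanlinna_T g 1"]
proof eventually_elim
  case (elim s)
  have "\<forall>\<^sub>F r in at_top. nevanlinna_T g r \<ge> s \<and> r \<ge> 1"
    using nevanlinna_T_entire_at_top[OF assms] unfolding filterlim_at_top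
    by (intro eventually_conj eventually_ge_at_top) blast
  then obtain b where b: "nevanlinna_T g b \<ge> s" "b \<ge> 1" using eventually_happens'[OF trivial_limit_at_top_linorder] by blast
  obtain x where "1 \<le> x" "x \<le> b" "nevanlinna_T g x = s"
    using IVT'[OF elim b nevanlinna_T_entire_continuous[OF hol]] by blast
  then have "s \<in> nevanlinna_T g ` {0<..}" by auto
  then show ?case
    using inv_into_into[of s "nevanlinna_T g" "{0<..}"] f_inv_into_f[of s "nevanlinna_T g" "{0<..}"]
    by (simp add: nevanlinna_T_inv_def)
qed

text \<open>A preimage \<open>R < K\<close> of \<open>s\<close> would force
  \<open>s \<le> ln (max 1 (max_modulus g K))\<close>, which fails for large
  \<open>s\<close>.\<close>

lemma nevanlinna_T_inv_at_top:
  assumes hol: "g holomorphic_on UNIV" and nc: "\<not> g constant_on UNIV"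
  shows "filterlim (nevanlinna_T_inv g) at_top at_top"
  unfolding filterlim_at_top
proof
  fix K :: real
  show "\<forall>\<^sub>F s in at_top. K \<le> nevanlinna_T_inv g s"
    using nevanlinna_T_inv_eventually[OF assms] eventually_gt_at_top[of "ln (max 1 (max_modulus g K))"]
  proof eventually_elim
    case (elim s)
    define R where "R = nevanlinna_T_inv g s"
    have R: "R > 0" "nevanlinna_T g R = s" using elim by (auto simp: R_def)
    show ?case
    proof (rule ccontr)
      assume "\<not> K \<le> nevanlinna_T_inv g s"
      then have "max_modulus g R \<le> max_modulus g K"
        using R by (intro max_modulus_mono[OF hol]) (auto simp: R_def)
      then have "ln (max 1 (max_modulus g R)) \<le> ln (max 1 (max_modulus g K))"
        by (intro ln_mono) (auto simp: max_def)
      then show False using nevanlinna_T_le_ln_max_modulus[OF hol R(1)] R elim by linarith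
    qed
  qed
qed

section \<open>Dichotomy for the characteristic of a meromorphic function\<close>

lemma nevanlinna_m_cong:
  assumes "countable X" and eq: "\<And>z. z \<notin> X \<Longrightarrow> f z = g z" and r: "r > 0"
  shows "nevanlinna_m f r = nevanlinna_m g r"
proof -
  have inj: "inj_on (\<lambda>\<theta>. of_real r * cis \<theta>) {0..<2*pi}"
    by (rule inj_on_inverseI[of _ Arg2pi], rule Arg2pi_unique) (use r in \<open>auto simp: cis_conv_exp\<close>)
  define N where "N = {\<theta> \<in> {0..<2*pi}. of_real r * cis \<theta> \<in> X}"
  have "countable ((\<lambda>\<theta>. of_real r * cis \<theta>) ` N)"
    by (rule countable_subset[OF _ \<open>countable X\<close>]) (auto simp: N_def)
  then have "countable N" by (rule countable_image_inj_on) (rule inj_on_subset[OF inj], auto simp: N_def)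
  \<comment> \<open>The angle \<open>2*pi\<close> repeats the angle 0 and lies outside the domain of
    injectivity, so it joins the null set separately.\<close>
  then have "negligible (\<Union>((\<lambda>x. {x}) ` insert (2*pi) N))"
    by (intro negligible_countable_Union) auto
  then have "negligible (insert (2*pi) N)" by simp
  then have "integral {0..2*pi} (\<lambda>\<theta>. ln (max 1 (norm (f (of_real r * cis \<theta>)))))
      = integral {0..2*pi} (\<lambda>\<theta>. ln (max 1 (norm (g (of_real r * cis \<theta>)))))"
    by (rule integral_spike) (auto simp: N_def eq)
  then show ?thesis by (simp add: nevanlinna_m_def)
qed

text \<open>A pole makes the counting function grow like \<open>ln r\<close>. Without poles
  \<open>f\<close> agrees off a countable set with an entire function, whose characteristic tends to
  infinity unless that function is constant.\<close>

lemma nevanlinna_T_at_top_or_constant: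
  assumes f: "f meromorphic_on UNIV"
  shows "filterlim (nevanlinna_T f) at_top at_top \<or> (\<exists>c. \<forall>r>0. nevanlinna_T f r = c)"
proof (cases "\<exists>z. is_pole f z")
  case True
  then obtain z where z: "is_pole f z" by blast
  have "filterlim (\<lambda>r. ln r - ln (max 1 (norm z))) at_top at_top" by real_asymp
  moreover have "\<forall>\<^sub>F r in at_top. ln r - ln (max 1 (norm z)) \<le> nevanlinna_T f r"
    using eventually_ge_at_top[of "max 1 (norm z)"]
  proof eventually_elim
    case (elim r)
    then show ?case
      using nevanlinna_N_ge[OF f z, of r] nevanlinna_m_nonneg[OF f, of r] by (simp add: nevanlinna_T_def)
  qed
  ultimately show ?thesis using filterlim_at_top_mono by blast
next
  case False
  define F where "F = remove_sings f"
  have "F analytic_on {z}" for z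
  proof -
    have "f meromorphic_on {z}" using f meromorphic_on_subset by blast
    then have iso: "isolated_singularity_at f z" "not_essential f z" by (auto simp: meromorphic_at_iff)
    then obtain c where "f \<midarrow>z\<rightarrow> c" using False by (auto simp: not_essential_def)
    then show ?thesis unfolding F_def using iso by (intro remove_sings_analytic_at)
  qed
  then have hol: "F holomorphic_on UNIV"
    using analytic_on_analytic_at analytic_imp_holomorphic by blast
  have T: "nevanlinna_T f r = nevanlinna_T F r" if "r > 0" for r
  proof -
    have "nevanlinna_m f r = nevanlinna_m F r"
      by (rule nevanlinna_m_cong[OF countable_singularities[OF f] _ that]) (simp add: F_def)
    then show ?thesis
      using False by (simp add: nevanlinna_T_entire[OF hol] nevanlinna_T_def nevanlinna_N_no_poles)
  qed
  show ?thesis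
  proof (cases "F constant_on UNIV")
    case True
    then obtain c where "\<And>z. F z = c" by (auto simp: constant_on_def)
    then have "nevanlinna_T F r = ln (max 1 (norm c))" for r
      by (simp add: nevanlinna_T_entire[OF hol] nevanlinna_m_def)
    then show ?thesis using T by auto
  next
    case False
    have "\<forall>\<^sub>F r in at_top. nevanlinna_T F r = nevanlinna_T f r"
      using eventually_gt_at_top[of 0] by eventually_elim (simp add: T)
    then have "filterlim (nevanlinna_T f) at_top at_top"
      using nevanlinna_T_entire_at_top[OF hol False] filterlim_cong[OF refl refl] by blast
    then show ?thesis ..
  qed
qed

section \<open>Property (A)\<close>

lemma funpow_ln_at_top: "filterlim (ln ^^ n) at_top (at_top :: real filter)"
proof (induction n)
  case 0
  then show ?case by (simp add: filterlim_ident id_def)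
next
  case (Suc n)
  then show ?case using filterlim_compose[OF ln_at_top Suc] by (simp add: o_def)
qed

lemma funpow_ln_mono:
  obtains K :: real where "K > 0" "\<And>x y. K \<le> x \<Longrightarrow> x \<le> y \<Longrightarrow> (ln ^^ n) x \<le> (ln ^^ n) y"
proof -
  have "\<exists>K>0. \<forall>x y. K \<le> x \<longrightarrow> x \<le> y \<longrightarrow> (ln ^^ n) x \<le> ((ln ^^ n) y :: real)"
  proof (induction n)
    case 0
    then show ?case by (auto intro: exI[of _ 1])
  next
    case (Suc n)
    then obtain K :: real where K: "K > 0" "\<And>x y. K \<le> x \<Longrightarrow> x \<le> y \<Longrightarrow> (ln ^^ n) x \<le> (ln ^^ n) y" by blast
    have "\<forall>\<^sub>F x in at_top. (ln ^^ n) x > (0 :: real)"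
      using funpow_ln_at_top[of n] by (simp add: filterlim_at_top_dense)
    then obtain L :: real where L: "\<And>x. x \<ge> L \<Longrightarrow> (ln ^^ n) x > 0" by (auto simp: eventually_at_top_linorder)
    show ?case
    \<comment> \<open>Above \<open>L\<close> the inner iterate is positive, where \<open>ln\<close>
      is increasing.\<close>
    proof (intro exI[of _ "max K L"] conjI allI impI)
      fix x y :: real assume "max K L \<le> x" "x \<le> y"
      then show "(ln ^^ Suc n) x \<le> (ln ^^ Suc n) y"
        using K(2)[of x y] L[of x] by (simp add: ln_mono)
    qed (use K in auto)
  qed
  then show thesis using that by blast
qed

text \<open>The first logarithm turns the exponent into the factor \<open>\<sigma>\<close>. Each
  further one turns this factor into the summand \<open>ln \<sigma>\<close>, which is at most
  \<open>\<sigma> - 1\<close> times the iterated logarithm once the latter reaches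
  \<open>ln \<sigma> / (\<sigma> - 1)\<close>.\<close>

lemma funpow_ln_powr_le:
  fixes \<sigma> :: real
  assumes n: "n \<ge> 1" and \<sigma>: "\<sigma> > 1"
  shows "\<forall>\<^sub>F x in at_top. (ln ^^ n) (x powr \<sigma>) \<le> \<sigma> * (ln ^^ n) x"
  using n
proof (induction n rule: nat_induct_at_least)
  case base
  show ?case using eventually_gt_at_top[of 0] by eventually_elim (simp add: ln_powr)
next
  case (Suc n)
  have powr_top: "filterlim (\<lambda>x. x powr \<sigma>) at_top at_top" using \<sigma> by real_asymp
  have "\<forall>\<^sub>F x in at_top. 0 < (ln ^^ n) (x powr \<sigma>)"
    using filterlim_compose[OF funpow_ln_at_top[of n] powr_top] by (simp add: filterlim_at_top_dense)
  moreover have "\<forall>\<^sub>F x in at_top. 0 < (ln ^^ n) (x :: real)"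
    using funpow_ln_at_top[of n] by (simp add: filterlim_at_top_dense)
  moreover have "\<forall>\<^sub>F x in at_top. ln \<sigma> / (\<sigma> - 1) \<le> (ln ^^ Suc n) x"
    using funpow_ln_at_top[of "Suc n"] unfolding filterlim_at_top by blast
  ultimately show ?case using Suc.IH
  proof eventually_elim
    case (elim x)
    have "(ln ^^ Suc n) (x powr \<sigma>) \<le> ln (\<sigma> * (ln ^^ n) x)"
      using elim \<sigma> by (simp add: ln_mono)
    also have "\<dots> = ln \<sigma> + (ln ^^ Suc n) x" using elim \<sigma> by (simp add: ln_mult)
    also have "ln \<sigma> \<le> (\<sigma> - 1) * (ln ^^ Suc n) x" using elim(3) \<sigma> by (simp add: field_simps)
    finally show ?case by (simp add: algebra_simps)
  qed
qed

section \<open>Iteration of Property (A)\<close>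

lemma property_A_power:
  assumes A: "property_A g" and \<tau>: "\<tau> > 1"
  shows "\<forall>\<^sub>F r in at_top. max_modulus g r ^ (2 ^ k) \<le> max_modulus g (r powr (\<tau> ^ k))"
proof (induction k)
  case 0
  show ?case using eventually_gt_at_top[of 0] by eventually_elim simp
next
  case (Suc k)
  have hol: "g holomorphic_on UNIV" using A by (simp add: property_A_def)
  have "\<tau> ^ k > 0" using \<tau> by simp
  then have top: "filterlim (\<lambda>r. r powr (\<tau> ^ k)) at_top at_top" by real_asymp
  have sq: "\<forall>\<^sub>F r in at_top. (max_modulus g r)\<^sup>2 \<le> max_modulus g (r powr \<tau>)"
    using A \<tau> by (simp add: property_A_def)
  \<comment> \<open>Each application at the point \<open>r powr (\<tau> ^ k)\<close> doubles the
    power of the maximum modulus, while the exponent of \<open>r\<close> gains only a factor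
    \<open>\<tau>\<close>.\<close>
  have "\<forall>\<^sub>F r in at_top. (max_modulus g (r powr (\<tau> ^ k)))\<^sup>2 \<le> max_modulus g ((r powr (\<tau> ^ k)) powr \<tau>)"
    by (rule eventually_compose_filterlim[OF sq top])
  then show ?case using Suc eventually_gt_at_top[of 0]
  proof eventually_elim
    case (elim r)
    have "0 \<le> norm (g (of_real r))" by simp
    also have "\<dots> \<le> max_modulus g r" using elim by (intro norm_le_max_modulus[OF hol]) simp
    finally have "max_modulus g r \<ge> 0" .
    then have "(max_modulus g r ^ 2 ^ k)\<^sup>2 \<le> (max_modulus g (r powr \<tau> ^ k))\<^sup>2"
      using elim by (intro power_mono) auto
    also have "\<dots> \<le> max_modulus g ((r powr (\<tau> ^ k)) powr \<tau>)" by (rule elim)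
    also have "(r powr (\<tau> ^ k)) powr \<tau> = r powr (\<tau> ^ Suc k)" by (simp add: powr_powr mult.commute)
    also have "(max_modulus g r ^ 2 ^ k)\<^sup>2 = max_modulus g r ^ 2 ^ Suc k"
      by (simp only: power_mult[symmetric] power_Suc2)
    finally show ?case .
  qed
qed

text \<open>The 12 and the halved radius match the bound of \<open>log M\<close> by the
  characteristic; the \<open>2\<close> and \<open>ln 2\<close> match the subadditivity bound for a
  sum.\<close>

lemma property_A_ln_max_modulus:
  assumes A: "property_A g" and \<sigma>: "\<sigma> > 1"
  shows "\<forall>\<^sub>F x in at_top. 12 * (2 * ln (max 1 (max_modulus g x)) + ln 2) < ln (max 1 (max_modulus g (x powr \<sigma> / 2)))"
proof -
  have hol: "g holomorphic_on UNIV" and nc: "\<not> g constant_on UNIV" using A by (auto simp: property_A_def)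
  \<comment> \<open>Six rounds of Property (A) with a seventh root of \<open>\<sigma>\<close> give
    the power \<open>2^6 = 64\<close> and leave the exponent
    \<open>\<sigma> - \<tau> ^ 6 > 0\<close> to absorb the division by 2.\<close>
  define \<tau> where "\<tau> = \<sigma> powr (1/7)"
  have \<tau>: "\<tau> > 1" using \<sigma> by (simp add: \<tau>_def)
  have "\<tau> ^ 7 = \<sigma>" using \<sigma> by (simp add: \<tau>_def powr_power)
  then have "\<tau> ^ 6 < \<sigma>" using \<tau> power_strict_increasing[of 6 7 \<tau>] by simp
  then have "filterlim (\<lambda>x. x powr (\<sigma> - \<tau> ^ 6)) at_top at_top" by real_asymp
  then have "\<forall>\<^sub>F x in at_top. x powr (\<sigma> - \<tau> ^ 6) \<ge> 2" by (simp add: filterlim_at_top)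
  moreover have "\<forall>\<^sub>F x in at_top. exp 1 \<le> max_modulus g x"
    using max_modulus_at_top[OF hol nc] unfolding filterlim_at_top by blast
  moreover note property_A_power[OF A \<tau>, of 6] eventually_gt_at_top[of 0]
  ultimately show ?thesis
  proof eventually_elim
    case (elim x)
    have "exp (1::real) > 1" by simp
    then have M: "max_modulus g x > 1" using elim(2) by linarith
    have "x powr \<sigma> = x powr (\<tau> ^ 6) * x powr (\<sigma> - \<tau> ^ 6)"
      using elim by (simp add: powr_add[symmetric])
    also have "\<dots> \<ge> x powr (\<tau> ^ 6) * 2" using elim by (intro mult_left_mono) auto
    finally have "x powr (\<tau> ^ 6) \<le> x powr \<sigma> / 2" by simp
    then have "max_modulus g (x powr (\<tau> ^ 6)) \<le> max_modulus g (x powr \<sigma> / 2)"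
      by (intro max_modulus_mono[OF hol]) auto
    then have le: "max_modulus g x ^ 64 \<le> max_modulus g (x powr \<sigma> / 2)" using elim by simp
    have one: "max_modulus g x ^ 64 \<ge> 1" using M by (intro one_le_power) simp
    have "64 * ln (max_modulus g x) = ln (max_modulus g x ^ 64)" using M by (simp add: ln_realpow)
    also have "\<dots> \<le> ln (max_modulus g (x powr \<sigma> / 2))" using le M by (intro ln_mono) auto
    finally have 1: "64 * ln (max_modulus g x) \<le> ln (max_modulus g (x powr \<sigma> / 2))" .
    have 2: "ln (max_modulus g x) \<ge> 1" using ln_mono[OF elim(2)] by simp
    have "ln (2::real) \<le> 1" using ln_le_minus_one[of "2::real"] by simp
    \<comment> \<open>As \<open>ln M(x) \<ge> 1 \<ge> ln 2\<close>, the left side is at most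
      \<open>36 * ln M(x)\<close>.\<close>
    then have "12 * (2 * ln (max_modulus g x) + ln 2) < 64 * ln (max_modulus g x)" using 2 by simp
    moreover have "1 \<le> max_modulus g (x powr \<sigma> / 2)" using le one by linarith
    ultimately show ?case using 1 M by (simp add: max_def)
  qed
qed

section \<open>From characteristics to growth ratios\<close>

lemma nevanlinna_T_inv_sum_le:
  assumes A: "property_A g" and \<sigma>: "\<sigma> > 1"
    and S: "filterlim S at_top at_top" and T: "filterlim T at_top at_top" and U: "filterlim U at_top at_top"
    and le: "\<forall>\<^sub>F r in at_top. U r \<le> S r + T r + ln 2"
  shows "\<forall>\<^sub>F r in at_top. nevanlinna_T_inv g (U r)
    \<le> max (nevanlinna_T_inv g (S r)) (nevanlinna_T_inv g (T r)) powr \<sigma>"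
proof -
  have hol: "g holomorphic_on UNIV" and nc: "\<not> g constant_on UNIV" using A by (auto simp: property_A_def)
  let ?R = "nevanlinna_T_inv g" and ?L = "\<lambda>x. ln (max 1 (max_modulus g x))"
  note inv = nevanlinna_T_inv_eventually[OF hol nc]
  have "filterlim (\<lambda>r. max (?R (S r)) (?R (T r))) at_top at_top"
    by (rule filterlim_at_top_mono[OF filterlim_compose[OF nevanlinna_T_inv_at_top[OF hol nc] S]]) auto
  from eventually_compose_filterlim[OF property_A_ln_max_modulus[OF A \<sigma>] this]
  show ?thesis
    using eventually_compose_filterlim[OF inv S] eventually_compose_filterlim[OF inv T]
      eventually_compose_filterlim[OF inv U] le
  proof eventually_elim
    case (elim r)
    define X where "X = max (?R (S r)) (?R (T r))"
    have L: "?L x \<le> ?L y" if "0 \<le> x" "x \<le> y" for x y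
      using max_modulus_mono[OF hol that] by (intro ln_mono) (auto simp: max_def)
    have X: "?R (S r) \<le> X" "?R (T r) \<le> X" by (auto simp: X_def)
    have T_le: "s \<le> ?L X" if "?R s > 0" "nevanlinna_T g (?R s) = s" "?R s \<le> X" for s
    proof -
      have "s \<le> ?L (?R s)" using nevanlinna_T_le_ln_max_modulus[OF hol that(1)] that(2) by simp
      also have "\<dots> \<le> ?L X" using that by (intro L) auto
      finally show ?thesis .
    qed
    have ST: "S r \<le> ?L X" "T r \<le> ?L X" using elim X by (intro T_le; blast)+
    show ?case
    \<comment> \<open>If the preimage of \<open>U r\<close> exceeded \<open>X powr \<sigma>\<close>,
      the growth from Property (A) would make \<open>12 * U r\<close> larger than
      \<open>12 * (2 * ?L X + ln 2)\<close>, which already bounds it.\<close>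
    proof (rule ccontr)
      assume "\<not> ?R (U r) \<le> max (?R (S r)) (?R (T r)) powr \<sigma>"
      then have "X powr \<sigma> / 2 \<le> ?R (U r) / 2" by (simp add: X_def)
      then have "?L (X powr \<sigma> / 2) \<le> ?L (?R (U r) / 2)" by (intro L) auto
      also have "\<dots> \<le> 12 * nevanlinna_T g (2 * (?R (U r) / 2))"
        using elim by (intro ln_max_modulus_le_nevanlinna_T[OF hol]) auto
      also have "\<dots> = 12 * U r" using elim by simp
      also have "\<dots> \<le> 12 * (2 * ?L X + ln 2)" using elim(5) ST by simp
      also have "\<dots> < ?L (X powr \<sigma> / 2)" using elim(1) unfolding X_def .
      finally show False by simp
    qed
  qed
qed

lemma growth_ratio_sum_le:
  assumes A: "property_A g" and \<sigma>: "\<sigma> > 1" and p: "p \<ge> 1"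
    and \<phi>: "filterlim (\<lambda>r. (ln ^^ q) (\<phi> r)) at_top at_top"
    and T: "\<And>f. f \<in> {f1, f2, h} \<Longrightarrow> filterlim (nevanlinna_T f) at_top at_top"
    and le: "\<forall>\<^sub>F r in at_top. nevanlinna_T h r \<le> nevanlinna_T f1 r + nevanlinna_T f2 r + ln 2"
  shows "\<forall>\<^sub>F r in at_top. growth_ratio p q \<phi> g h r
    \<le> \<sigma> * max (growth_ratio p q \<phi> g f1 r) (growth_ratio p q \<phi> g f2 r)"
proof -
  have hol: "g holomorphic_on UNIV" and nc: "\<not> g constant_on UNIV" using A by (auto simp: property_A_def)
  let ?R = "\<lambda>f r. nevanlinna_T_inv g (nevanlinna_T f r)"
  have R: "filterlim (?R f) at_top at_top" if "f \<in> {f1, f2, h}" for f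
    using filterlim_compose[OF nevanlinna_T_inv_at_top[OF hol nc] T[OF that]] .
  have X: "filterlim (\<lambda>r. max (?R f1 r) (?R f2 r)) at_top at_top"
    by (rule filterlim_at_top_mono[OF R[of f1]]) auto
  obtain K where K: "K > 0" "\<And>x y. K \<le> x \<Longrightarrow> x \<le> y \<Longrightarrow> (ln ^^ p) x \<le> ((ln ^^ p) y :: real)"
    using funpow_ln_mono by blast
  have "\<forall>\<^sub>F r in at_top. K \<le> ?R h r" using R[of h] by (simp add: filterlim_at_top)
  moreover have "\<forall>\<^sub>F r in at_top. 0 < (ln ^^ q) (\<phi> r)" using \<phi> by (simp add: filterlim_at_top_dense)
  moreover have "\<forall>\<^sub>F r in at_top. ?R h r \<le> max (?R f1 r) (?R f2 r) powr \<sigma>"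
    by (intro nevanlinna_T_inv_sum_le[OF A \<sigma> _ _ _ le] T) auto
  moreover note eventually_compose_filterlim[OF funpow_ln_powr_le[OF p \<sigma>] X]
  ultimately show ?thesis
  proof eventually_elim
    case (elim r)
    define X where "X = max (?R f1 r) (?R f2 r)"
    have "(ln ^^ p) (?R h r) \<le> (ln ^^ p) (X powr \<sigma>)" using K(2) elim by (simp add: X_def)
    also have "\<dots> \<le> \<sigma> * (ln ^^ p) X" using elim by (simp add: X_def)
    \<comment> \<open>A maximum is one of its two arguments, so its iterated logarithm is one of the
      two on the right.\<close>
    also have "\<dots> \<le> \<sigma> * max ((ln ^^ p) (?R f1 r)) ((ln ^^ p) (?R f2 r))"
      using \<sigma> by (intro mult_left_mono) (auto simp: X_def max_def)
    finally have "growth_ratio p q \<phi> g h r \<le> \<sigma> * max ((ln ^^ p) (?R f1 r)) ((ln ^^ p) (?R f2 r)) / (ln ^^ q) (\<phi> r)"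
      unfolding growth_ratio_def using elim by (intro divide_right_mono) auto
    also have "\<dots> = \<sigma> * max (growth_ratio p q \<phi> g f1 r) (growth_ratio p q \<phi> g f2 r)"
      using elim by (simp add: growth_ratio_def max_divide_distrib_right times_divide_eq_right[symmetric] del: times_divide_eq_right)
    finally show ?case .
  qed
qed

text \<open>A lower limit of a maximum can exceed both lower limits, since \<open>b\<close> and
  \<open>c\<close> may be small at different places. An upper limit for \<open>c\<close> keeps it
  small at all late \<open>r\<close>, so \<open>b\<close> alone would have to be large.\<close>

lemma Liminf_le_max_Liminf_Limsup:
  fixes a b c :: "real \<Rightarrow> real"
  assumes le: "\<And>\<sigma>. \<sigma> > 1 \<Longrightarrow> \<forall>\<^sub>F r in at_top. a r \<le> \<sigma> * max (b r) (c r)"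
    and nonneg: "\<forall>\<^sub>F r in at_top. b r \<ge> 0"
  shows "Liminf at_top (\<lambda>r. ereal (a r)) \<le> max (Liminf at_top (\<lambda>r. ereal (b r))) (Limsup at_top (\<lambda>r. ereal (c r)))"
    (is "?a \<le> max ?b ?c")
proof (rule ccontr)
  assume "\<not> ?a \<le> max ?b ?c"
  then have "max ?b ?c < ?a" by (simp only: not_le)
  then obtain s where s: "max ?b ?c < ereal s" "ereal s < ?a" using ereal_dense2 by blast
  obtain t where t: "ereal s < ereal t" "ereal t < ?a" using ereal_dense2[OF s(2)] by blast
  \<comment> \<open>Nonnegativity of \<open>b\<close> makes \<open>s\<close> positive, so that the
    factor \<open>t / s\<close> can serve as \<open>\<sigma>\<close>.\<close>
  have "0 \<le> ?b" by (rule Liminf_bounded) (use nonneg in simp)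
  then have "0 \<le> max ?b ?c" by (simp add: le_max_iff_disj)
  then have "0 < ereal s" using s(1) by (rule order_le_less_trans)
  then have st: "0 < s" "s < t" using t by auto
  have "\<forall>\<^sub>F r in at_top. ereal (a r) > ereal t" using t(2) by (rule less_LiminfD)
  moreover have "\<forall>\<^sub>F r in at_top. ereal (c r) < ereal s" using s(1) by (intro Limsup_lessD) (simp only: max_less_iff_conj)
  moreover have "\<forall>\<^sub>F r in at_top. a r \<le> (t / s) * max (b r) (c r)" using st by (intro le) simp
  ultimately have "\<forall>\<^sub>F r in at_top. ereal s \<le> ereal (b r)"
  proof eventually_elim
    case (elim r)
    show ?case
    proof (rule ccontr)
      assume "\<not> ereal s \<le> ereal (b r)"
      then have "max (b r) (c r) < s" using elim by simp
      then have "(t / s) * max (b r) (c r) < (t / s) * s" using st by (intro mult_strict_left_mono) auto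
      then show False using elim st by simp
    qed
  qed
  then have "ereal s \<le> ?b" by (rule Liminf_bounded)
  then have "ereal s \<le> max ?b ?c" by (simp only: le_max_iff_disj simp_thms)
  then show False using s(1) by (rule leD[THEN notE])
qed

section \<open>Relative lower order\<close>

lemma monotone_unbounded_at_top:
  fixes \<phi> :: "real \<Rightarrow> real"
  assumes "mono_on {0..} \<phi>" and "\<not> bdd_above (\<phi> ` {0..})"
  shows "filterlim \<phi> at_top at_top"
  unfolding filterlim_at_top
proof
  fix B :: real
  obtain x where x: "x \<ge> 0" "\<phi> x > B"
    using assms(2) unfolding bdd_above_def by (auto simp: not_le)
  show "\<forall>\<^sub>F r in at_top. B \<le> \<phi> r"
    using eventually_ge_at_top[of x]
  proof eventually_elim
    case (elim r)
    then have "\<phi> x \<le> \<phi> r" using x by (intro mono_onD[OF assms(1)]) auto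
    then show ?case using x by linarith
  qed
qed

text \<open>The numerator is one fixed number, whatever \<open>inv_into\<close> returns at
  \<open>c\<close>, while the denominator tends to infinity.\<close>

lemma rel_lower_order_constant:
  assumes \<phi>: "filterlim (\<lambda>r. (ln ^^ q) (\<phi> r)) at_top at_top"
    and c: "\<And>r. r > 0 \<Longrightarrow> nevanlinna_T f r = c"
  shows "rel_lower_order p q \<phi> g f = 0"
proof -
  have "((\<lambda>r. (ln ^^ p) (nevanlinna_T_inv g c) / (ln ^^ q) (\<phi> r)) \<longlongrightarrow> 0) at_top"
    by (rule tendsto_divide_0[OF tendsto_const filterlim_at_top_imp_at_infinity[OF \<phi>]])
  moreover have "\<forall>\<^sub>F r in at_top. (ln ^^ p) (nevanlinna_T_inv g c) / (ln ^^ q) (\<phi> r) = growth_ratio p q \<phi> g f r"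
    using eventually_gt_at_top[of 0] by eventually_elim (simp add: growth_ratio_def c)
  ultimately have "(growth_ratio p q \<phi> g f \<longlongrightarrow> 0) at_top"
    by (rule Lim_transform_eventually)
  then have "((\<lambda>r. ereal (growth_ratio p q \<phi> g f r)) \<longlongrightarrow> ereal 0) at_top"
    by (rule tendsto_ereal)
  then show ?thesis
    unfolding rel_lower_order_def by (simp add: lim_imp_Liminf zero_ereal_def)
qed

lemma growth_ratio_eventually_nonneg:
  assumes "g holomorphic_on UNIV" "\<not> g constant_on UNIV"
    and \<phi>: "filterlim (\<lambda>r. (ln ^^ q) (\<phi> r)) at_top at_top"
    and T: "filterlim (nevanlinna_T f) at_top at_top"
  shows "\<forall>\<^sub>F r in at_top. growth_ratio p q \<phi> g f r \<ge> 0"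
proof -
  have "filterlim (\<lambda>r. (ln ^^ p) (nevanlinna_T_inv g (nevanlinna_T f r))) at_top at_top"
    using filterlim_compose[OF funpow_ln_at_top filterlim_compose[OF nevanlinna_T_inv_at_top[OF assms(1,2)] T]] .
  then have "\<forall>\<^sub>F r in at_top. 0 \<le> (ln ^^ p) (nevanlinna_T_inv g (nevanlinna_T f r))"
    by (simp add: filterlim_at_top)
  moreover have "\<forall>\<^sub>F r in at_top. 0 \<le> (ln ^^ q) (\<phi> r)" using \<phi> by (simp add: filterlim_at_top)
  ultimately show ?thesis by eventually_elim (simp add: growth_ratio_def)
qed

text \<open>Only an inequality of characteristics ties the three functions together, so the bound
  also applies with \<open>h\<close> as one of the summands. The regular summand stands
  second.\<close>

lemma rel_lower_order_sum_le:
  assumes A: "property_A g" and p: "p \<ge> 1"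
    and \<phi>: "filterlim (\<lambda>r. (ln ^^ q) (\<phi> r)) at_top at_top"
    and T: "\<And>f. f \<in> {f1, f2, h} \<Longrightarrow> filterlim (nevanlinna_T f) at_top at_top"
    and le: "\<And>r. r \<ge> 1 \<Longrightarrow> nevanlinna_T h r \<le> nevanlinna_T f1 r + nevanlinna_T f2 r + ln 2"
    and reg: "regular_growth p q \<phi> g f2"
  shows "rel_lower_order p q \<phi> g h \<le> max (rel_lower_order p q \<phi> g f1) (rel_lower_order p q \<phi> g f2)"
proof -
  have hol: "g holomorphic_on UNIV" and nc: "\<not> g constant_on UNIV" using A by (auto simp: property_A_def)
  have "\<forall>\<^sub>F r in at_top. nevanlinna_T h r \<le> nevanlinna_T f1 r + nevanlinna_T f2 r + ln 2"
    using eventually_ge_at_top[of 1] by eventually_elim (rule le)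
  then have "rel_lower_order p q \<phi> g h \<le> max (rel_lower_order p q \<phi> g f1) (rel_order p q \<phi> g f2)"
    unfolding rel_lower_order_def rel_order_def
    by (intro Liminf_le_max_Liminf_Limsup growth_ratio_sum_le[OF A _ p \<phi>] growth_ratio_eventually_nonneg[OF hol nc \<phi>] T) auto
  then show ?thesis using reg by (simp add: regular_growth_def)
qed

theorem theorem1:
  fixes p q :: nat
    and \<phi> :: "real \<Rightarrow> real"
    and f1 f2 g1 h :: "complex \<Rightarrow> complex"
  assumes "p \<ge> 1" and "q \<ge> 1"
    and "\<forall>r\<ge>0. \<phi> r > 0"
    and "mono_on {0..} \<phi>"
    and "\<not> bdd_above (\<phi> ` {0..})"
    and "f1 meromorphic_on UNIV" and "f2 meromorphic_on UNIV"
    and "g1 holomorphic_on UNIV"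
    and "h = (\<lambda>z. f1 z + f2 z) \<or> h = (\<lambda>z. f1 z - f2 z)"
    and "\<forall>f\<in>{f1, f2, h}. rel_lower_order p q \<phi> g1 f \<noteq> 0 \<and> \<bar>rel_lower_order p q \<phi> g1 f\<bar> \<noteq> \<infinity>"
    and "regular_growth p q \<phi> g1 f1 \<or> regular_growth p q \<phi> g1 f2"
    and "property_A g1"
  shows "rel_lower_order p q \<phi> g1 h
           \<le> max (rel_lower_order p q \<phi> g1 f1) (rel_lower_order p q \<phi> g1 f2) \<and>
         ((rel_lower_order p q \<phi> g1 f1 > rel_lower_order p q \<phi> g1 f2 \<and> regular_growth p q \<phi> g1 f2) \<or>
          (rel_lower_order p q \<phi> g1 f2 > rel_lower_order p q \<phi> g1 f1 \<and> regular_growth p q \<phi> g1 f1)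
          \<longrightarrow> rel_lower_order p q \<phi> g1 h
               = max (rel_lower_order p q \<phi> g1 f1) (rel_lower_order p q \<phi> g1 f2))"
proof -
  note f = assms(6,7)
  let ?L = "rel_lower_order p q \<phi> g1"
  have h: "h meromorphic_on UNIV" using assms(9) f by (auto intro: meromorphic_intros)
  have \<phi>: "filterlim (\<lambda>r. (ln ^^ q) (\<phi> r)) at_top at_top"
    using filterlim_compose[OF funpow_ln_at_top monotone_unbounded_at_top[OF assms(4,5)]] .
  \<comment> \<open>A constant characteristic would make the lower order 0, against the standing
    assumption.\<close>
  have T: "filterlim (nevanlinna_T k) at_top at_top" if "k \<in> {f1, f2, h}" for k
  proof -
    have "k meromorphic_on UNIV" "?L k \<noteq> 0" using that f h assms(10) by auto
    then show ?thesis using nevanlinna_T_at_top_or_constant[of k] rel_lower_order_constant[OF \<phi>, of k] by metis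
  qed
  have h_le: "nevanlinna_T h r \<le> nevanlinna_T f1 r + nevanlinna_T f2 r + ln 2" if "r \<ge> 1" for r
    using assms(9) nevanlinna_T_add_le[OF f that] nevanlinna_T_diff_le[OF f that] by auto
  \<comment> \<open>Here \<open>f1\<close> is \<open>h - f2\<close> or \<open>h + f2\<close>,
    according to the sign in \<open>h\<close>.\<close>
  have f1_le: "nevanlinna_T f1 r \<le> nevanlinna_T h r + nevanlinna_T f2 r + ln 2" if "r \<ge> 1" for r
    using assms(9) nevanlinna_T_add_le[OF h f(2) that] nevanlinna_T_diff_le[OF h f(2) that] by auto
  \<comment> \<open>Here \<open>f2\<close> is \<open>h - f1\<close> or \<open>f1 - h\<close>, a
    difference for either sign.\<close>
  have f2_le: "nevanlinna_T f2 r \<le> nevanlinna_T h r + nevanlinna_T f1 r + ln 2" if "r \<ge> 1" for r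
    using assms(9) nevanlinna_T_diff_le[OF h f(1) that] nevanlinna_T_diff_le[OF f(1) h that] by auto
  note bound = rel_lower_order_sum_le[OF assms(12,1) \<phi>]
  have le: "?L h \<le> max (?L f1) (?L f2)"
    using assms(11)
  proof
    assume "regular_growth p q \<phi> g1 f1"
    moreover have "nevanlinna_T h r \<le> nevanlinna_T f2 r + nevanlinna_T f1 r + ln 2" if "r \<ge> 1" for r
      using h_le[OF that] by simp
    ultimately have "?L h \<le> max (?L f2) (?L f1)" by (intro bound T) auto
    then show ?thesis by (simp add: max.commute)
  next
    assume "regular_growth p q \<phi> g1 f2"
    then show ?thesis by (intro bound T h_le) auto
  qed
  moreover have "?L h = max (?L f1) (?L f2)" if "?L f2 < ?L f1" "regular_growth p q \<phi> g1 f2"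
  proof -
    \<comment> \<open>As \<open>?L f1\<close> exceeds \<open>?L f2\<close>, the maximum on the right
      can only be \<open>?L h\<close>, which gives the reverse inequality.\<close>
    have "?L f1 \<le> max (?L h) (?L f2)" using that(2) by (intro bound T f1_le) auto
    then show ?thesis using le that(1) by (auto simp: max_def split: if_splits)
  qed
  moreover have "?L h = max (?L f1) (?L f2)" if "?L f1 < ?L f2" "regular_growth p q \<phi> g1 f1"
  proof -
    have "?L f2 \<le> max (?L h) (?L f1)" using that(2) by (intro bound T f2_le) auto
    then show ?thesis using le that(1) by (auto simp: max_def split: if_splits)
  qed
  ultimately show ?thesis by blast
qed

end
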